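(* Let $A=\begin{pmatrix}a&b\\c&d\end{pmatrix}\colon\mathbb{R}\to\mathfrak{sp}(\mathbb{R}^{2n})$, and set $$C\coloneqq\tfrac12\bigl(a-d-\mathrm{i}(b+c)\bigr),\qquad D\coloneqq\tfrac12\bigl(a+d+\mathrm{i}(b-c)\bigr).$$ The Riccati flow $\partial u=C+Du-u(D^\ast+C^\ast u)$ on $\mathrm{U}_{\mathrm{sym}}(\mathbb{C}^n)$ has the form $$\partial u=\xi u-u\xi^\ast,$$ where $\xi\colon\mathbb{R}\times\mathrm{U}_{\mathrm{sym}}(\mathbb{C}^n)\to\mathfrak{u}(\mathbb{C}^n)$ is given by $$\xi=\xi(x,u)\coloneqq D-\tfrac12\bigl(uC^\ast-Cu^\dagger\bigr).$$ We can pull back the flow $u\colon\mathbb{R}\to\mathrm{U}_{\mathrm{sym}}(\mathbb{C}^n)$ (via the group action, $u=g\,u_0\,g^{\mathrm{T}}$ with $u_0$ the initial value of $u$) to the flow $g\colon\mathbb{R}\to\mathrm{U}(\mathbb{C}^n)$ on the unitary group given by $$\partial g=\xi\,g.$$ Hence we can pull back the flow $g\colon\mathbb{R}\to\mathrm{U}(\mathbb{C}^n)$ (via the exponential map, $g=\exp\sigma$) to the flow $\sigma\colon\mathbb{R}\to\mathfrak{u}(\mathbb{C}^n)$ on the unitary Lie algebra given by $$\partial\sigma=\mathrm{dexp}_\sigma^{-1}\circ\xi.$$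
   Context: $\mathfrak{sp}(\mathbb{R}^{2n})$ is the Lie algebra of real $2n\times2n$ block matrices $\begin{pmatrix}a&b\\c&d\end{pmatrix}$ with $n\times n$ blocks, $b$ and $c$ symmetric and $a=-d^{\mathrm{T}}$; $\partial$ is the derivative with respect to $x\in\mathbb{R}$. $\mathrm{U}(\mathbb{C}^n)$ is the unitary group, $\mathfrak{u}(\mathbb{C}^n)$ its Lie algebra of $n\times n$ complex matrices $\zeta$ with $\zeta^\dagger=-\zeta$, and $\mathrm{U}_{\mathrm{sym}}(\mathbb{C}^n)$ is the manifold of unitary matrices $u$ with $u^{\mathrm{T}}=u$. The superscript $\ast$ is entrywise complex conjugation (without transpose), and $\dagger$ is the complex conjugate transpose. The Riccati flow for $u$ is the image, under the Cayley map $s\mapsto u=(\mathrm{id}-\mathrm{i}s)(\mathrm{id}+\mathrm{i}s)^{-1}$, of the Riccati equation $\partial s=c+ds-s(a+bs)$ on real symmetric $n\times n$ matrices $s$. The group $\mathrm{U}(\mathbb{C}^n)$ acts transitively on $\mathrm{U}_{\mathrm{sym}}(\mathbb{C}^n)$ by $(g,u)\mapsto gug^{\mathrm{T}}$, with corresponding Lie algebra action $(\xi,u)\mapsto\xi u-u\xi^\ast$. In the pulled-back equations $\xi$ is evaluated along the flow, i.e. at $u=g\,u_0\,g^{\mathrm{T}}$, respectively $u=\exp(\sigma)\,u_0\,\exp(\sigma)^{\mathrm{T}}$, with initial data $g(x_0)=\mathrm{id}$, respectively $\sigma(x_0)=O$, where $u_0=u(x_0)$. The operator $\mathrm{dexp}_\sigma^{-1}\colon\mathfrak{u}(\mathbb{C}^n)\to\mathfrak{u}(\mathbb{C}^n)$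 is $\mathrm{dexp}_\sigma^{-1}\coloneqq\mathrm{ad}_\sigma/(\exp\mathrm{ad}_\sigma-\mathrm{id})$, where $\mathrm{ad}_\sigma\circ\zeta\coloneqq[\sigma,\zeta]=\sigma\zeta-\zeta\sigma$ for $\sigma,\zeta\in\mathfrak{u}(\mathbb{C}^n)$.
   Formalization: Existence of g for a given flow u is stated for continuous A; the flow σ is not claimed on all of ℝ, but exists on an open interval around x₀, and its equation is equivalent to that of g = exp σ on any open interval where σ is differentiable and dexp_σ⁻¹ exists. *)

theory Defs
  imports "HOL-Analysis.Analysis"
begin

text \<open>
  Matrices are \<open>'a ^ 'n ^ 'n\<close> with product \<open>**\<close>. Beware that \<open>*\<close>, \<open>1\<close> and \<open>^\<close> on this
  type are entrywise; the identity matrix is \<open>mat 1\<close>. The phase space of dimension \<open>2n\<close> is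
  indexed by \<open>'n + 'n\<close>, the summands labelling the two block rows and columns.
\<close>

section \<open>Complex matrices\<close>

definition cmat_of_real :: "real ^ 'n ^ 'm \<Rightarrow> complex ^ 'n ^ 'm" where
  "cmat_of_real M = map_matrix complex_of_real M"

definition cscale :: "complex \<Rightarrow> complex ^ 'n ^ 'm \<Rightarrow> complex ^ 'n ^ 'm" where
  "cscale z M = map_matrix (\<lambda>w. z * w) M"

definition conj_mat :: "complex ^ 'n ^ 'm \<Rightarrow> complex ^ 'n ^ 'm" where
  "conj_mat M = map_matrix cnj M"

definition dagger :: "complex ^ 'n ^ 'm \<Rightarrow> complex ^ 'm ^ 'n" where
  "dagger M = transpose (conj_mat M)"

definition unitary_group :: "(complex ^ 'n ^ 'n) set" where
  "unitary_group = {g. dagger g ** g = mat 1 \<and> g ** dagger g = mat 1}"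

definition unitary_sym :: "(complex ^ 'n ^ 'n) set" where
  "unitary_sym = {u \<in> unitary_group. transpose u = u}"

definition unitary_algebra :: "(complex ^ 'n ^ 'n) set" where
  "unitary_algebra = {\<zeta>. dagger \<zeta> = - \<zeta>}"

section \<open>The symplectic Lie algebra and the Riccati flow\<close>

definition block_a :: "real ^ ('n::finite + 'n) ^ ('n + 'n) \<Rightarrow> real ^ 'n ^ 'n" where
  "block_a A = (\<chi> i j. A $ Inl i $ Inl j)"

definition block_b :: "real ^ ('n::finite + 'n) ^ ('n + 'n) \<Rightarrow> real ^ 'n ^ 'n" where
  "block_b A = (\<chi> i j. A $ Inl i $ Inr j)"

definition block_c :: "real ^ ('n::finite + 'n) ^ ('n + 'n) \<Rightarrow> real ^ 'n ^ 'n" where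
  "block_c A = (\<chi> i j. A $ Inr i $ Inl j)"

definition block_d :: "real ^ ('n::finite + 'n) ^ ('n + 'n) \<Rightarrow> real ^ 'n ^ 'n" where
  "block_d A = (\<chi> i j. A $ Inr i $ Inr j)"

definition sp_algebra :: "(real ^ ('n::finite + 'n) ^ ('n + 'n)) set" where
  "sp_algebra = {A. transpose (block_b A) = block_b A \<and> transpose (block_c A) = block_c A \<and>
                    block_a A = - transpose (block_d A)}"

definition riccati_C :: "real ^ ('n::finite + 'n) ^ ('n + 'n) \<Rightarrow> complex ^ 'n ^ 'n" where
  "riccati_C A = cscale (1/2)
     (cmat_of_real (block_a A) - cmat_of_real (block_d A)
       - cscale \<i> (cmat_of_real (block_b A) + cmat_of_real (block_c A)))"

definition riccati_D :: "real ^ ('n::finite + 'n) ^ ('n + 'n) \<Rightarrow> complex ^ 'n ^ 'n" where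
  "riccati_D A = cscale (1/2)
     (cmat_of_real (block_a A) + cmat_of_real (block_d A)
       + cscale \<i> (cmat_of_real (block_b A) - cmat_of_real (block_c A)))"

definition cayley :: "real ^ 'n ^ 'n \<Rightarrow> complex ^ 'n ^ 'n" where
  "cayley s = (mat 1 - cscale \<i> (cmat_of_real s)) ** matrix_inv (mat 1 + cscale \<i> (cmat_of_real s))"

definition real_riccati_flow_on ::
  "real set \<Rightarrow> (real \<Rightarrow> real ^ ('n::finite + 'n) ^ ('n + 'n)) \<Rightarrow> (real \<Rightarrow> real ^ 'n ^ 'n) \<Rightarrow> bool" where
  "real_riccati_flow_on J A s \<longleftrightarrow> (\<forall>x\<in>J. transpose (s x) = s x \<and>
     (s has_vector_derivative
        (block_c (A x) + block_d (A x) ** s x - s x ** (block_a (A x) + block_b (A x) ** s x)))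
       (at x))"

definition riccati_field :: "real ^ ('n::finite + 'n) ^ ('n + 'n) \<Rightarrow> complex ^ 'n ^ 'n \<Rightarrow> complex ^ 'n ^ 'n" where
  "riccati_field A u = riccati_C A + riccati_D A ** u
     - u ** (conj_mat (riccati_D A) + conj_mat (riccati_C A) ** u)"

definition riccati_flow_on ::
  "real set \<Rightarrow> (real \<Rightarrow> real ^ ('n::finite + 'n) ^ ('n + 'n)) \<Rightarrow> (real \<Rightarrow> complex ^ 'n ^ 'n) \<Rightarrow> bool" where
  "riccati_flow_on J A u \<longleftrightarrow> (\<forall>x\<in>J. u x \<in> unitary_sym \<and>
     (u has_vector_derivative riccati_field (A x) (u x)) (at x))"

text \<open>\<open>riccati_xi (A x) u\<close> is the generator \<open>\<xi>(x, u)\<close>, which depends on \<open>x\<close> only through \<open>A x\<close>.\<close>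

definition riccati_xi :: "real ^ ('n::finite + 'n) ^ ('n + 'n) \<Rightarrow> complex ^ 'n ^ 'n \<Rightarrow> complex ^ 'n ^ 'n" where
  "riccati_xi A u = riccati_D A
     - cscale (1/2) (u ** conj_mat (riccati_C A) - riccati_C A ** dagger u)"

definition unitary_flow_on ::
  "real set \<Rightarrow> (real \<Rightarrow> real ^ ('n::finite + 'n) ^ ('n + 'n)) \<Rightarrow> complex ^ 'n ^ 'n
    \<Rightarrow> (real \<Rightarrow> complex ^ 'n ^ 'n) \<Rightarrow> bool" where
  "unitary_flow_on J A u\<^sub>0 g \<longleftrightarrow> (\<forall>x\<in>J. g x \<in> unitary_group \<and>
     (g has_vector_derivative riccati_xi (A x) (g x ** u\<^sub>0 ** transpose (g x)) ** g x) (at x))"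

section \<open>Exponential map and its inverse trivialised differential\<close>

definition mexp :: "complex ^ 'n ^ 'n \<Rightarrow> complex ^ 'n ^ 'n" where
  "mexp \<sigma> = (\<Sum>k. (1 / fact k) *\<^sub>R (((**) \<sigma>) ^^ k) (mat 1))"

definition ad :: "complex ^ 'n ^ 'n \<Rightarrow> complex ^ 'n ^ 'n \<Rightarrow> complex ^ 'n ^ 'n" where
  "ad \<sigma> \<zeta> = \<sigma> ** \<zeta> - \<zeta> ** \<sigma>"

definition exp_ad :: "complex ^ 'n ^ 'n \<Rightarrow> complex ^ 'n ^ 'n \<Rightarrow> complex ^ 'n ^ 'n" where
  "exp_ad \<sigma> \<zeta> = (\<Sum>k. (1 / fact k) *\<^sub>R (ad \<sigma> ^^ k) \<zeta>)"

text \<open>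
  Since \<open>ad \<sigma>\<close> is never injective, \<open>ad \<sigma> / (exp (ad \<sigma>) - id)\<close> cannot be read as a product with an
  inverse of \<open>exp (ad \<sigma>) - id\<close>. As usual it is the function \<open>z / (exp z - 1)\<close>, with its removable
  singularity at \<open>0\<close> removed, of the operator \<open>ad \<sigma>\<close>: the inverse of the operator \<open>dexp \<sigma>\<close> obtained
  from the entire function \<open>(exp z - 1) / z = (\<Sum>k. z ^ k / (k+1)!)\<close>. The poles \<open>z = 2 \<pi> \<i> m\<close>
  with \<open>m \<noteq> 0\<close> remain: \<open>dexp_inv \<sigma>\<close> is meaningful exactly if \<open>dexp_invertible \<sigma>\<close>, that is, if
  none of them is an eigenvalue of \<open>ad \<sigma>\<close>.
\<close>

definition dexp :: "complex ^ 'n ^ 'n \<Rightarrow> complex ^ 'n ^ 'n \<Rightarrow> complex ^ 'n ^ 'n" where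
  "dexp \<sigma> \<zeta> = (\<Sum>k. (1 / fact (Suc k)) *\<^sub>R (ad \<sigma> ^^ k) \<zeta>)"

definition dexp_invertible :: "complex ^ 'n ^ 'n \<Rightarrow> bool" where
  "dexp_invertible \<sigma> \<longleftrightarrow> bij_betw (dexp \<sigma>) unitary_algebra unitary_algebra"

definition dexp_inv :: "complex ^ 'n ^ 'n \<Rightarrow> complex ^ 'n ^ 'n \<Rightarrow> complex ^ 'n ^ 'n" where
  "dexp_inv \<sigma> = inv_into unitary_algebra (dexp \<sigma>)"

definition lie_flow_on ::
  "real set \<Rightarrow> (real \<Rightarrow> real ^ ('n::finite + 'n) ^ ('n + 'n)) \<Rightarrow> complex ^ 'n ^ 'n
    \<Rightarrow> (real \<Rightarrow> complex ^ 'n ^ 'n) \<Rightarrow> bool" where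
  "lie_flow_on J A u\<^sub>0 \<sigma> \<longleftrightarrow> (\<forall>x\<in>J. \<sigma> x \<in> unitary_algebra \<and> dexp_invertible (\<sigma> x) \<and>
     (\<sigma> has_vector_derivative
        dexp_inv (\<sigma> x) (riccati_xi (A x) (mexp (\<sigma> x) ** u\<^sub>0 ** transpose (mexp (\<sigma> x))))) (at x))"

text \<open>The series above converge, and \<open>dexp \<sigma>\<close> is a quotient of \<open>exp (ad \<sigma>) - id\<close> by \<open>ad \<sigma>\<close>.\<close>

lemma bounded_linear_ad: "bounded_linear (ad \<sigma>)"
proof -
  have "linear (ad \<sigma>)"
    by (rule linearI)
      (simp_all add: ad_def vec_eq_iff matrix_matrix_mult_def distrib_left distrib_right sum.distrib
        scaleR_sum_right scaleR_diff_right)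
  then show ?thesis by (rule linear_conv_bounded_linear[THEN iffD1])
qed

lemma norm_funpow_le:
  fixes L :: "'a::real_normed_vector \<Rightarrow> 'a"
  assumes "\<And>y. norm (L y) \<le> K * norm y" "K \<ge> 0"
  shows "norm ((L ^^ k) y) \<le> K ^ k * norm y"
proof (induction k)
  case (Suc k)
  have "norm ((L ^^ Suc k) y) \<le> K * norm ((L ^^ k) y)" using assms(1) by simp
  also have "\<dots> \<le> K * (K ^ k * norm y)" using Suc assms(2) by (rule mult_left_mono)
  finally show ?case by (simp add: mult.assoc)
qed simp

lemma summable_funpow_fact:
  fixes L :: "'a::banach \<Rightarrow> 'a"
  assumes "bounded_linear L" and c: "\<And>k. \<bar>c k\<bar> \<le> 1 / fact k"
  shows "summable (\<lambda>k. c k *\<^sub>R (L ^^ k) y)"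
proof -
  obtain K where K: "\<And>y. norm (L y) \<le> K * norm y" "K \<ge> 0"
    using bounded_linear.nonneg_bounded[OF assms(1)] by (auto simp: mult.commute)
  have "summable (\<lambda>k. inverse (fact k) * K ^ k * norm y)"
    by (rule summable_mult2[OF summable_exp])
  then show ?thesis
  proof (rule summable_comparison_test'[where N = 0])
    fix k :: nat
    have "norm (c k *\<^sub>R (L ^^ k) y) = \<bar>c k\<bar> * norm ((L ^^ k) y)" by simp
    also have "\<dots> \<le> (1 / fact k) * (K ^ k * norm y)"
      using c norm_funpow_le[of L K k y] K by (intro mult_mono) auto
    finally show "norm (c k *\<^sub>R (L ^^ k) y) \<le> inverse (fact k) * K ^ k * norm y"
      by (simp add: field_simps)
  qed
qed

lemma summable_dexp: "summable (\<lambda>k. (1 / fact (Suc k)) *\<^sub>R (ad \<sigma> ^^ k) \<zeta>)"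
proof (rule summable_funpow_fact[OF bounded_linear_ad])
  fix k :: nat
  show "\<bar>1 / fact (Suc k)\<bar> \<le> 1 / (fact k :: real)"
    using fact_mono[of k "Suc k", where 'a = real] by (auto intro!: divide_left_mono simp del: fact_Suc)
qed

lemma summable_exp_ad: "summable (\<lambda>k. (1 / fact k) *\<^sub>R (ad \<sigma> ^^ k) \<zeta>)"
  by (rule summable_funpow_fact[OF bounded_linear_ad]) auto

lemma ad_dexp: "ad \<sigma> (dexp \<sigma> \<zeta>) = exp_ad \<sigma> \<zeta> - \<zeta>"
proof -
  have "ad \<sigma> (dexp \<sigma> \<zeta>) = (\<Sum>k. ad \<sigma> ((1 / fact (Suc k)) *\<^sub>R (ad \<sigma> ^^ k) \<zeta>))"
    unfolding dexp_def by (rule bounded_linear.suminf[OF bounded_linear_ad summable_dexp])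
  also have "\<dots> = (\<Sum>k. (1 / fact (Suc k)) *\<^sub>R (ad \<sigma> ^^ Suc k) \<zeta>)"
    by (simp add: bounded_linear.linear[OF bounded_linear_ad] linear_cmul del: fact_Suc)
  also have "\<dots> = exp_ad \<sigma> \<zeta> - \<zeta>"
    unfolding exp_ad_def using suminf_split_head[OF summable_exp_ad[of \<sigma> \<zeta>]] by simp
  finally show ?thesis .
qed

lemma summable_mexp:
  fixes \<sigma> :: "complex ^ 'n ^ 'n"
  shows "summable (\<lambda>k. (1 / fact k) *\<^sub>R (((**) \<sigma>) ^^ k) (mat 1))"
proof -
  have "linear ((**) \<sigma> :: complex ^ 'n ^ 'n \<Rightarrow> _)"
    by (rule linearI)
      (simp_all add: vec_eq_iff matrix_matrix_mult_def distrib_left sum.distrib scaleR_sum_right)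
  then have "bounded_linear ((**) \<sigma> :: complex ^ 'n ^ 'n \<Rightarrow> _)"
    by (rule linear_conv_bounded_linear[THEN iffD1])
  then show ?thesis by (rule summable_funpow_fact) auto
qed

end

theory Submission
  imports Defs
begin

text \<open>
  Writing \<open>P = mat 1 + \<i> s\<close>, the Cayley transform is \<open>u = 2 P\<^sup>-\<^sup>1 - mat 1\<close>, so that
  \<open>\<partial>u = - 2 \<i> P\<^sup>-\<^sup>1 (\<partial>s) P\<^sup>-\<^sup>1\<close>, and \<open>s\<close> is recovered from \<open>P = 2 (u + mat 1)\<^sup>-\<^sup>1\<close>; hence the two
  Riccati flows correspond. Given \<open>u\<close>, the linear equation \<open>\<partial>g = \<xi> g\<close> with \<open>\<xi> = \<xi>(x, u x)\<close> has a
  global solution, given by its Picard series, and since \<open>\<xi>\<close> is anti-Hermitian both \<open>g\<^sup>\<dagger> g\<close> and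
  \<open>g\<^sup>\<dagger> u g\<^sup>*\<close> are constant. The flow on the Lie algebra comes from
  \<open>\<partial>(exp \<sigma>) = dexp\<^sub>\<sigma>(\<partial>\<sigma>) exp \<sigma>\<close>, proved by comparing power series, and a differentiable
  logarithm near the identity comes from the inverse function theorem.
\<close>

section \<open>Complex matrices and the Riccati vector field\<close>

text \<open>The equation in \<open>unitary_flow_on\<close> is nonlinear in g, since the generator is
  evaluated at g u0 g^T. Freezing the generator along the given u makes the equation linear, so that
  no solution blows up inside the interval. From g to u, the product rule suffices.

  The passage to the Lie algebra is local. The logarithm inverts the exponential near 0 in the space
  of all complex matrices, so its construction does not make its values anti-Hermitian; this is
  recovered from the uniqueness of logarithms close to 0. Moreover \<open>dexp \<sigma>\<close> has
  to stay invertible along the flow, which can fail when \<open>ad \<sigma>\<close> has an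
  eigenvalue 2 pi i m with m \<noteq> 0. The inverse function theorem also makes the derivative of
  the exponential bijective at every value of the logarithm, and this yields the
  invertibility.\<close>

lemma norm_matrix_mult_le:
  fixes X :: "'a::{real_normed_algebra,semiring_1} ^ 'm ^ 'n" and Y :: "'a ^ 'p ^ 'm"
  shows "norm (X ** Y) \<le> norm X * norm Y"
proof -
  \<comment> \<open>The norm of nested vectors is the Frobenius norm, and \<open>c j\<close> is the
    Euclidean norm of column j of Y. Cauchy-Schwarz bounds each entry by a row norm times a column
    norm, and the squares of these products sum to a product.\<close>
  define c where "c j = L2_set (\<lambda>k. norm (Y $ k $ j)) UNIV" for j
  have entry: "norm ((X ** Y) $ i $ j) \<le> norm (X $ i) * c j" for i j
  proof -
    have "norm ((X ** Y) $ i $ j) \<le> (\<Sum>k\<in>UNIV. norm (X $ i $ k * Y $ k $ j))"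
      unfolding matrix_matrix_mult_def by (simp add: norm_sum)
    also have "\<dots> \<le> (\<Sum>k\<in>UNIV. \<bar>norm (X $ i $ k)\<bar> * \<bar>norm (Y $ k $ j)\<bar>)"
      by (rule sum_mono) (simp add: norm_mult_ineq)
    also have "\<dots> \<le> norm (X $ i) * c j"
      unfolding c_def norm_vec_def[of "X $ i"] by (rule L2_set_mult_ineq)
    finally show ?thesis .
  qed
  have c: "(\<Sum>j\<in>UNIV. (c j)\<^sup>2) = (norm Y)\<^sup>2"
    unfolding c_def norm_vec_def L2_set_def
    by (simp add: sum_nonneg real_sqrt_pow2 sum.swap[of _ "UNIV :: 'p set"])
  have "(norm (X ** Y))\<^sup>2 = (\<Sum>i\<in>UNIV. \<Sum>j\<in>UNIV. (norm ((X ** Y) $ i $ j))\<^sup>2)"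
    unfolding norm_vec_def L2_set_def by (simp add: sum_nonneg real_sqrt_pow2)
  also have "\<dots> \<le> (\<Sum>i\<in>UNIV. \<Sum>j\<in>UNIV. (norm (X $ i) * c j)\<^sup>2)"
    by (intro sum_mono power_mono entry norm_ge_zero)
  also have "\<dots> = (\<Sum>i\<in>UNIV. (norm (X $ i))\<^sup>2) * (\<Sum>j\<in>UNIV. (c j)\<^sup>2)"
    by (simp add: power_mult_distrib sum_product)
  also have "\<dots> = (norm X * norm Y)\<^sup>2"
    unfolding c power_mult_distrib norm_vec_def[of X] L2_set_def by (simp add: sum_nonneg real_sqrt_pow2)
  finally show ?thesis by (rule power2_le_imp_le) simp
qed

text \<open>Source of the product rules, limit laws and continuity facts for matrix products used
  below.\<close>

interpretation matmul: bounded_bilinear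
  "(**) :: complex ^ 'm ^ 'n \<Rightarrow> complex ^ 'p ^ 'm \<Rightarrow> complex ^ 'p ^ 'n"
proof
  show "\<exists>K. \<forall>(X :: complex ^ 'm ^ 'n) (Y :: complex ^ 'p ^ 'm). norm (X ** Y) \<le> norm X * norm Y * K"
    by (intro exI[of _ 1]) (simp add: norm_matrix_mult_le)
qed (simp_all add: vec_eq_iff matrix_matrix_mult_def distrib_left distrib_right sum.distrib
      scaleR_sum_right)

lemma bounded_linear_dagger: "bounded_linear (dagger :: complex ^ 'n ^ 'm \<Rightarrow> _)"
  unfolding linear_conv_bounded_linear[symmetric] dagger_def conj_mat_def transpose_def
  by (rule linearI) (simp_all add: vec_eq_iff)

lemma bounded_linear_transpose: "bounded_linear (transpose :: complex ^ 'n ^ 'm \<Rightarrow> _)"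
  unfolding linear_conv_bounded_linear[symmetric] transpose_def
  by (rule linearI) (simp_all add: vec_eq_iff)

lemma bounded_linear_conj_mat: "bounded_linear (conj_mat :: complex ^ 'n ^ 'm \<Rightarrow> _)"
  unfolding linear_conv_bounded_linear[symmetric] conj_mat_def
  by (rule linearI) (simp_all add: vec_eq_iff)

lemma bounded_linear_cscale: "bounded_linear (cscale z :: complex ^ 'n ^ 'm \<Rightarrow> _)"
  unfolding linear_conv_bounded_linear[symmetric] cscale_def
  by (rule linearI) (simp_all add: vec_eq_iff distrib_left)

lemma bounded_linear_cmat_of_real: "bounded_linear (cmat_of_real :: real ^ 'n ^ 'm \<Rightarrow> _)"
  unfolding linear_conv_bounded_linear[symmetric] cmat_of_real_def
  by (rule linearI) (simp_all add: vec_eq_iff scaleR_conv_of_real[where 'a=complex])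

lemmas dagger_add = linear_add[OF bounded_linear.linear[OF bounded_linear_dagger]]
  and dagger_diff = linear_diff[OF bounded_linear.linear[OF bounded_linear_dagger]]
  and dagger_minus = linear_neg[OF bounded_linear.linear[OF bounded_linear_dagger]]
lemmas transpose_add = linear_add[OF bounded_linear.linear[OF bounded_linear_transpose]]
  and transpose_diff = linear_diff[OF bounded_linear.linear[OF bounded_linear_transpose]]
lemmas conj_mat_add = linear_add[OF bounded_linear.linear[OF bounded_linear_conj_mat]]
  and conj_mat_diff = linear_diff[OF bounded_linear.linear[OF bounded_linear_conj_mat]]
lemmas cscale_add = linear_add[OF bounded_linear.linear[OF bounded_linear_cscale]]
  and cscale_diff = linear_diff[OF bounded_linear.linear[OF bounded_linear_cscale]]
lemmas cmat_of_real_add = linear_add[OF bounded_linear.linear[OF bounded_linear_cmat_of_real]]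
  and cmat_of_real_diff = linear_diff[OF bounded_linear.linear[OF bounded_linear_cmat_of_real]]
  and cmat_of_real_minus = linear_neg[OF bounded_linear.linear[OF bounded_linear_cmat_of_real]]

lemma dagger_mult: "dagger (X ** Y) = dagger Y ** dagger X"
  by (simp add: dagger_def conj_mat_def transpose_def vec_eq_iff matrix_matrix_mult_def mult.commute)

lemma conj_mat_mult: "conj_mat (X ** Y) = conj_mat X ** conj_mat Y"
  by (simp add: conj_mat_def vec_eq_iff matrix_matrix_mult_def)

lemma cmat_of_real_mult: "cmat_of_real (X ** Y) = cmat_of_real X ** cmat_of_real Y"
  by (simp add: cmat_of_real_def vec_eq_iff matrix_matrix_mult_def)

lemma dagger_mat_1 [simp]: "dagger (mat 1) = mat 1"
  by (simp add: dagger_def conj_mat_def transpose_def vec_eq_iff mat_def)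

lemma conj_mat_mat_1 [simp]: "conj_mat (mat 1) = mat 1"
  by (simp add: conj_mat_def vec_eq_iff mat_def)

lemma dagger_dagger [simp]: "dagger (dagger X) = X"
  by (simp add: dagger_def conj_mat_def transpose_def vec_eq_iff)

lemma conj_mat_conj_mat [simp]: "conj_mat (conj_mat X) = X"
  by (simp add: conj_mat_def vec_eq_iff)

lemma conj_mat_dagger [simp]: "conj_mat (dagger X) = transpose X"
  by (simp add: dagger_def conj_mat_def transpose_def vec_eq_iff)

lemma conj_mat_cmat_of_real [simp]: "conj_mat (cmat_of_real X) = cmat_of_real X"
  by (simp add: conj_mat_def cmat_of_real_def vec_eq_iff)

lemma transpose_cmat_of_real: "transpose (cmat_of_real X) = cmat_of_real (transpose X)"
  by (simp add: transpose_def cmat_of_real_def vec_eq_iff)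

lemma transpose_cscale: "transpose (cscale z X) = cscale z (transpose X)"
  by (simp add: transpose_def cscale_def vec_eq_iff)

lemma conj_mat_cscale: "conj_mat (cscale z X) = cscale (cnj z) (conj_mat X)"
  by (simp add: conj_mat_def cscale_def vec_eq_iff)

lemma dagger_cscale: "dagger (cscale z X) = cscale (cnj z) (dagger X)"
  by (simp add: dagger_def transpose_def conj_mat_def cscale_def vec_eq_iff)

lemma cscale_mult_left: "cscale z X ** Y = cscale z (X ** Y)"
  by (simp add: cscale_def vec_eq_iff matrix_matrix_mult_def sum_distrib_left mult.assoc)

lemma cscale_mult_right: "X ** cscale z Y = cscale z (X ** Y)"
  by (simp add: cscale_def vec_eq_iff matrix_matrix_mult_def sum_distrib_left mult.left_commute)

lemma cscale_nth [simp]: "cscale z X $ i $ j = z * X $ i $ j"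
  by (simp add: cscale_def)

lemma cscale_cscale [simp]: "cscale z (cscale w X) = cscale (z * w) X"
  by (simp add: vec_eq_iff mult.assoc)

section \<open>The unitary group and its action on symmetric unitary matrices\<close>

lemma unitary_group_iff: "g \<in> unitary_group \<longleftrightarrow> dagger g ** g = mat 1"
  unfolding unitary_group_def using matrix_left_right_inverse by blast

lemma unitary_groupD: "g \<in> unitary_group \<Longrightarrow> dagger g ** g = mat 1"
    "g \<in> unitary_group \<Longrightarrow> g ** dagger g = mat 1"
  by (simp_all add: unitary_group_def)

lemma unitary_mult:
  assumes "g \<in> unitary_group" "h \<in> unitary_group"
  shows "g ** h \<in> unitary_group"
proof -
  have "dagger (g ** h) ** (g ** h) = dagger h ** (dagger g ** g) ** h"
    by (simp only: dagger_mult matrix_mul_assoc)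
  then show ?thesis using assms by (simp add: unitary_group_iff)
qed

lemma unitary_transpose:
  assumes "g \<in> unitary_group"
  shows "transpose g \<in> unitary_group"
proof -
  have "dagger (transpose g) ** transpose g = conj_mat (g ** dagger g)"
    by (simp add: dagger_def conj_mat_def transpose_def vec_eq_iff matrix_matrix_mult_def)
  then show ?thesis using unitary_groupD(2)[OF assms] by (simp add: unitary_group_iff)
qed

lemma unitary_sym_action:
  assumes "g \<in> unitary_group" "u \<in> unitary_sym"
  shows "g ** u ** transpose g \<in> unitary_sym"
  using assms unfolding unitary_sym_def
  by (simp add: unitary_mult unitary_transpose matrix_transpose_mul matrix_mul_assoc)

lemma unitary_sym_conj:
  assumes "u \<in> unitary_sym"
  shows "dagger u = conj_mat u" "u ** conj_mat u = mat 1" "conj_mat u ** u = mat 1"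
proof -
  show d: "dagger u = conj_mat u"
    using assms unfolding unitary_sym_def dagger_def
    by (simp add: transpose_def conj_mat_def vec_eq_iff)
  show "u ** conj_mat u = mat 1" "conj_mat u ** u = mat 1"
    using assms unitary_groupD[of u] unfolding unitary_sym_def d by auto
qed

section \<open>Coefficients and generator of the Riccati flow\<close>

lemma riccati_C_sym:
  assumes "A \<in> sp_algebra"
  shows "transpose (riccati_C A) = riccati_C A"
proof -
  have 1: "transpose (block_d A) = - block_a A" using assms by (simp add: sp_algebra_def)
  have 2: "transpose (block_a A) = - block_d A" using assms unfolding sp_algebra_def
    by (auto simp: transpose_def vec_eq_iff)
  show ?thesis using assms
    unfolding riccati_C_def sp_algebra_def
    by (simp add: transpose_cscale transpose_diff transpose_add transpose_cmat_of_real 1 2 cmat_of_real_minus)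
qed

text \<open>From a^T = -d, the real matrix a + d is antisymmetric, while b - c is real symmetric and
  carries the factor i.\<close>

lemma riccati_D_antihermitian:
  assumes "A \<in> sp_algebra"
  shows "dagger (riccati_D A) = - riccati_D A"
proof -
  have 1: "transpose (block_d A) = - block_a A" using assms by (simp add: sp_algebra_def)
  have 2: "transpose (block_a A) = - block_d A" using assms unfolding sp_algebra_def
    by (auto simp: transpose_def vec_eq_iff)
  have r: "dagger (cmat_of_real X) = cmat_of_real (transpose X)" for X :: "real ^ 'b ^ 'c"
    by (simp add: dagger_def transpose_cmat_of_real)
  show ?thesis using assms
    unfolding riccati_D_def sp_algebra_def
    by (simp add: dagger_cscale dagger_diff dagger_add r 1 2 cmat_of_real_minus)
      (simp add: vec_eq_iff algebra_simps)
qed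

text \<open>For X = u conj(C), the symmetry of C gives X^dagger = C u^dagger. Hence the half
  difference in the generator is the anti-Hermitian part of X, and D is anti-Hermitian by
  itself.\<close>

lemma riccati_xi_antihermitian:
  assumes A: "A \<in> sp_algebra" and u: "u \<in> unitary_sym"
  shows "riccati_xi A u \<in> unitary_algebra"
proof -
  have 1: "dagger (conj_mat (riccati_C A)) = riccati_C A"
    using riccati_C_sym[OF A] by (simp add: dagger_def)
  then have 2: "dagger (riccati_C A) = conj_mat (riccati_C A)" by (metis dagger_dagger)
  show ?thesis
    unfolding unitary_algebra_def riccati_xi_def
    by (simp add: dagger_diff dagger_cscale dagger_mult 1 2 riccati_D_antihermitian[OF A])
      (simp add: vec_eq_iff algebra_simps)
qed

text \<open>The terms C and u conj(C) u each arise twice with weight 1/2, once from the left and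
  once from the right product with the generator, because u conj(u) is the identity.\<close>

lemma riccati_field_xi:
  assumes A: "A \<in> sp_algebra" and u: "u \<in> unitary_sym"
  shows "riccati_field A u = riccati_xi A u ** u - u ** conj_mat (riccati_xi A u)"
proof -
  let ?C = "riccati_C A" and ?D = "riccati_D A"
  note c = unitary_sym_conj[OF u]
  have "?C ** conj_mat u ** u = ?C" "u ** (conj_mat u ** ?C) = ?C"
    using c by (metis matrix_mul_assoc matrix_mul_lid matrix_mul_rid)+
  then show ?thesis
    unfolding riccati_field_def riccati_xi_def c(1)
    by (simp add: matmul.diff_left matmul.diff_right matrix_add_ldistrib conj_mat_diff conj_mat_cscale
        conj_mat_mult cscale_mult_left cscale_mult_right matrix_mul_assoc cscale_diff)
      (simp add: vec_eq_iff field_simps)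
qed

section \<open>Linear ordinary differential equations\<close>

text \<open>Weierstrass test for termwise differentiation. The tail of \<open>M\<close> controls the
  remainder for all points and directions at once. It serves both the Picard series and the
  exponential series.\<close>

lemma has_derivative_suminf:
  fixes f :: "nat \<Rightarrow> 'a::real_normed_vector \<Rightarrow> 'b::banach"
  assumes S: "convex S"
    and f': "\<And>n x. x \<in> S \<Longrightarrow> (f n has_derivative f' n x) (at x within S)"
    and bound: "\<And>n x h. x \<in> S \<Longrightarrow> norm (f' n x h) \<le> M n * norm h"
    and M: "summable M"
    and x\<^sub>0: "x\<^sub>0 \<in> S" "summable (\<lambda>n. f n x\<^sub>0)"
    and x: "x \<in> S"
  shows "summable (\<lambda>n. f n x)"
    and "((\<lambda>x. \<Sum>n. f n x) has_derivative (\<lambda>h. \<Sum>n. f' n x h)) (at x within S)"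
proof -
  have norm_sm: "summable (\<lambda>n. norm (f' n x h))" if "x \<in> S" for x h
    by (rule summable_comparison_test[OF _ summable_mult2[OF M, of "norm h"]])
      (use bound[OF that] in auto)
  have unif: "\<forall>\<^sub>F n in sequentially. \<forall>x\<in>S. \<forall>h.
      norm (sum (\<lambda>i. f' i x h) {..<n} - (\<Sum>i. f' i x h)) \<le> e * norm h" if "e > 0" for e
  proof -
    obtain N where N: "\<And>n. n \<ge> N \<Longrightarrow> norm (\<Sum>i. M (i + n)) < e"
      using suminf_exist_split[OF \<open>e > 0\<close> M] by blast
    have "norm (sum (\<lambda>i. f' i x h) {..<n} - (\<Sum>i. f' i x h)) \<le> e * norm h"
      if n: "n \<ge> N" and x: "x \<in> S" for n x h
    proof -
      have sm: "summable (\<lambda>i. norm (f' (i + n) x h))"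
        by (rule summable_ignore_initial_segment[OF norm_sm[OF x]])
      have "norm (sum (\<lambda>i. f' i x h) {..<n} - (\<Sum>i. f' i x h)) = norm (\<Sum>i. f' (i + n) x h)"
        using suminf_minus_initial_segment[OF summable_norm_cancel[OF norm_sm[OF x]]]
        by (simp add: norm_minus_commute)
      also have "\<dots> \<le> (\<Sum>i. norm (f' (i + n) x h))"
        by (rule summable_norm[OF sm])
      also have "\<dots> \<le> (\<Sum>i. M (i + n) * norm h)"
        using M bound[OF x] sm by (intro suminf_le summable_mult2) (simp_all add: summable_iff_shift)
      also have "\<dots> = (\<Sum>i. M (i + n)) * norm h"
        using M by (intro suminf_mult2[symmetric]) (simp add: summable_iff_shift)
      also have "\<dots> \<le> e * norm h"
        using N[OF n] by (intro mult_right_mono) auto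
      finally show ?thesis .
    qed
    then show ?thesis unfolding eventually_sequentially by blast
  qed
  obtain g where g: "\<And>x. x \<in> S \<Longrightarrow> (\<lambda>n. f n x) sums g x"
      "\<And>x. x \<in> S \<Longrightarrow> (g has_derivative (\<lambda>h. \<Sum>n. f' n x h)) (at x within S)"
    using has_derivative_series[OF S f' unif x\<^sub>0(1) summable_sums[OF x\<^sub>0(2)]] by blast
  show "summable (\<lambda>n. f n x)" using g(1)[OF x] by (rule sums_summable)
  show "((\<lambda>x. \<Sum>n. f n x) has_derivative (\<lambda>h. \<Sum>n. f' n x h)) (at x within S)"
    by (rule has_derivative_transform[OF x _ g(2)[OF x]]) (use g(1) sums_unique in fastforce)
qed

text \<open>The point x must be interior, so that a derivative within \<open>{a..b}\<close> is a
  derivative at x; the base point may be an endpoint.\<close>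

lemma open_interval_contains_Icc:
  fixes J :: "real set"
  assumes "open J" "is_interval J" "x\<^sub>0 \<in> J" "x \<in> J"
  obtains a b where "a < x" "x < b" "a \<le> x\<^sub>0" "x\<^sub>0 \<le> b" "{a..b} \<subseteq> J"
proof -
  obtain e where e: "e > 0" "cball x e \<subseteq> J"
    using assms(1,4) by (auto simp: open_contains_cball)
  have "x - e \<in> J" "x + e \<in> J" using e by (auto simp: dist_real_def)
  then have "min x\<^sub>0 (x - e) \<in> J" "max x\<^sub>0 (x + e) \<in> J"
    using assms(3) by (auto simp: min_def max_def)
  then have "{min x\<^sub>0 (x - e)..max x\<^sub>0 (x + e)} \<subseteq> J"
    using assms(2) unfolding is_interval_1 by (meson atLeastAtMost_iff subsetI)
  then show ?thesis using e(1) by (intro that[of "min x\<^sub>0 (x - e)" "max x\<^sub>0 (x + e)"]) auto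
qed

lemma open_interval_antiderivative:
  fixes f :: "real \<Rightarrow> 'a::euclidean_space"
  assumes J: "open J" "is_interval J" "x\<^sub>0 \<in> J" and f: "continuous_on J f"
  obtains F where "F x\<^sub>0 = 0" "\<And>x. x \<in> J \<Longrightarrow> (F has_vector_derivative f x) (at x)"
proof (rule that[of "\<lambda>u. LBINT y=x\<^sub>0..u. f y"])
  show "(LBINT y=x\<^sub>0..x\<^sub>0. f y) = 0" by simp
  fix x assume "x \<in> J"
  obtain a b where ab: "a < x" "x < b" "a \<le> x\<^sub>0" "x\<^sub>0 \<le> b" "{a..b} \<subseteq> J"
    by (rule open_interval_contains_Icc[OF J \<open>x \<in> J\<close>])
  have "((\<lambda>u. LBINT y=x\<^sub>0..u. f y) has_vector_derivative f x) (at x within {a..b})"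
    using ab f by (intro interval_integral_FTC2) (auto intro: continuous_on_subset)
  then show "((\<lambda>u. LBINT y=x\<^sub>0..u. f y) has_vector_derivative f x) (at x)"
    using ab by (simp add: at_within_Icc_at)
qed

text \<open>One step of the Picard estimate: integrating a bound of degree n raises the degree and
  contributes the factor 1/(n+1), from which the factorial builds up.\<close>

lemma norm_antiderivative_le_power:
  fixes F :: "real \<Rightarrow> 'a::real_normed_vector"
  assumes F0: "F x\<^sub>0 = 0"
    and F': "\<And>x. x \<in> {a..b} \<Longrightarrow> (F has_vector_derivative f x) (at x)"
    and f: "\<And>x. x \<in> {a..b} \<Longrightarrow> norm (f x) \<le> K * \<bar>x - x\<^sub>0\<bar> ^ n"
    and x: "x\<^sub>0 \<in> {a..b}" "x \<in> {a..b}"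
  shows "norm (F x) \<le> K * \<bar>x - x\<^sub>0\<bar> ^ Suc n / real (Suc n)"
proof (cases "x = x\<^sub>0")
  case False
  \<comment> \<open>Running from the base point towards x with a parameter t \<ge> 0 treats both
    sides alike and replaces the absolute value by the smooth power of t.\<close>
  define s where "s = sgn (x - x\<^sub>0)"
  define r where "r = \<bar>x - x\<^sub>0\<bar>"
  have s: "\<bar>s\<bar> = 1" and r: "r > 0" and sr: "x\<^sub>0 + s * r = x"
    using False by (auto simp: s_def r_def sgn_real_def)
  have in_ab: "x\<^sub>0 + s * t \<in> {a..b}" if "t \<in> {0..r}" for t
    using x that by (auto simp: s_def r_def sgn_real_def split: if_splits)
  have "norm (F (x\<^sub>0 + s * r) - F (x\<^sub>0 + s * 0))
      \<le> K * r ^ Suc n / real (Suc n) - K * 0 ^ Suc n / real (Suc n)"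
  proof (rule differentiable_bound_general[OF r])
    have D: "((\<lambda>t. F (x\<^sub>0 + s * t)) has_vector_derivative s *\<^sub>R f (x\<^sub>0 + s * t)) (at t)"
      if "t \<in> {0..r}" for t
    proof -
      have "((\<lambda>t. x\<^sub>0 + s * t) has_vector_derivative s) (at t)"
        by (auto intro!: derivative_eq_intros)
      from vector_diff_chain_at[OF this F'[OF in_ab[OF that]]] show ?thesis by (simp add: o_def)
    qed
    show "continuous_on {0..r} (\<lambda>t. F (x\<^sub>0 + s * t))"
      by (rule continuous_at_imp_continuous_on) (use D has_vector_derivative_continuous in blast)
    show "continuous_on {0..r} (\<lambda>t. K * t ^ Suc n / real (Suc n))"
      by (intro continuous_intros) auto
    fix t assume t: "0 < t" "t < r"
    show "((\<lambda>t. F (x\<^sub>0 + s * t)) has_vector_derivative s *\<^sub>R f (x\<^sub>0 + s * t)) (at t)"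
      by (rule D) (use t in auto)
    have "((\<lambda>t. K * t ^ Suc n / real (Suc n)) has_real_derivative K * t ^ n) (at t)"
      using DERIV_cdivide[OF DERIV_cmult[OF DERIV_pow[of "Suc n" t UNIV], of K], of "real (Suc n)"]
      by (simp del: of_nat_Suc power_Suc)
    then show "((\<lambda>t. K * t ^ Suc n / real (Suc n)) has_vector_derivative K * t ^ n) (at t)"
      by (rule has_real_derivative_iff_has_vector_derivative[THEN iffD1])
    show "norm (s *\<^sub>R f (x\<^sub>0 + s * t)) \<le> K * t ^ n"
      using f[OF in_ab[of t]] t s by (simp add: abs_mult)
  qed
  then show ?thesis unfolding sr by (simp add: F0 r_def)
qed (simp add: F0)

text \<open>The n-th Picard term is an n-fold iterated integral, bounded on a compact subinterval by
  |c| (M |t - x0|)^n / n!, where M bounds L only there. Since every point of J lies inside such a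
  subinterval, the series solves the equation on all of J, even if L is unbounded on J.\<close>

lemma linear_ode_exists:
  fixes L :: "real \<Rightarrow> 'a::euclidean_space \<Rightarrow>\<^sub>L 'a"
  assumes J: "open J" "is_interval J" "x\<^sub>0 \<in> J" and L: "continuous_on J L"
  obtains y where "y x\<^sub>0 = c" "\<And>x. x \<in> J \<Longrightarrow> (y has_vector_derivative L x (y x)) (at x)"
proof -
  \<comment> \<open>Continuity is carried along because the next term is an antiderivative; the
    implication for n = 0 pins down the initial term.\<close>
  have "\<exists>G. \<forall>n. (continuous_on J (G n) \<and> (n = 0 \<longrightarrow> G n = (\<lambda>_. c))) \<and>
      (G (Suc n) x\<^sub>0 = 0 \<and> (\<forall>x\<in>J. (G (Suc n) has_vector_derivative L x (G n x)) (at x)))"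
  proof (rule dependent_nat_choice)
    fix g :: "real \<Rightarrow> 'a" and n :: nat
    assume g: "continuous_on J g \<and> (n = 0 \<longrightarrow> g = (\<lambda>_. c))"
    then have "continuous_on J (\<lambda>x. L x (g x))" using L by (intro continuous_intros) auto
    then obtain G where G: "G x\<^sub>0 = 0" "\<And>x. x \<in> J \<Longrightarrow> (G has_vector_derivative L x (g x)) (at x)"
      using open_interval_antiderivative[OF J] by blast
    moreover have "continuous_on J G"
      by (rule continuous_at_imp_continuous_on) (use G(2) has_vector_derivative_continuous in blast)
    ultimately show "\<exists>G. (continuous_on J G \<and> (Suc n = 0 \<longrightarrow> G = (\<lambda>_. c))) \<and>
        (G x\<^sub>0 = 0 \<and> (\<forall>x\<in>J. (G has_vector_derivative L x (g x)) (at x)))"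
      by auto
  qed auto
  then obtain G where G0: "G 0 = (\<lambda>_. c)" and Gx: "\<And>n. G (Suc n) x\<^sub>0 = 0"
    and G': "\<And>n x. x \<in> J \<Longrightarrow> (G (Suc n) has_vector_derivative L x (G n x)) (at x)"
    by blast
  \<comment> \<open>The derivative of the n-th term. The index shift makes the derivative series
    equal to \<open>L x\<close> applied to the original series.\<close>
  define G1 where "G1 n x = (case n of 0 \<Rightarrow> 0 | Suc m \<Rightarrow> L x (G m x))" for n x
  have G1: "(G n has_vector_derivative G1 n x) (at x)" if "x \<in> J" for n x
    using G'[OF that] by (cases n) (auto simp: G1_def G0)
  have "((\<lambda>x. \<Sum>n. G n x) has_vector_derivative L x (\<Sum>n. G n x)) (at x)" if "x \<in> J" for x
  proof -
    obtain a b where ab: "a < x" "x < b" "a \<le> x\<^sub>0" "x\<^sub>0 \<le> b" "{a..b} \<subseteq> J"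
      by (rule open_interval_contains_Icc[OF J \<open>x \<in> J\<close>])
    have "compact (L ` {a..b})"
      by (intro compact_continuous_image continuous_on_subset[OF L] ab) auto
    then obtain M where M: "M > 0" "\<And>t. t \<in> {a..b} \<Longrightarrow> norm (L t) \<le> M"
      by (auto dest!: compact_imp_bounded simp: bounded_pos)
    have G_le: "norm (G n t) \<le> norm c * M ^ n / fact n * \<bar>t - x\<^sub>0\<bar> ^ n" if "t \<in> {a..b}" for n t
      using that
    proof (induction n arbitrary: t)
      case (Suc n)
      have "norm (G (Suc n) t) \<le> (norm c * M ^ Suc n / fact n) * \<bar>t - x\<^sub>0\<bar> ^ Suc n / real (Suc n)"
      proof (rule norm_antiderivative_le_power[where F = "G (Suc n)" and f = "\<lambda>t. L t (G n t)"])
        show "norm (L t (G n t)) \<le> norm c * M ^ Suc n / fact n * \<bar>t - x\<^sub>0\<bar> ^ n" if "t \<in> {a..b}" for t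
        proof -
          have "norm (L t (G n t)) \<le> norm (L t) * norm (G n t)" by (rule norm_blinfun)
          also have "\<dots> \<le> M * (norm c * M ^ n / fact n * \<bar>t - x\<^sub>0\<bar> ^ n)"
            using M Suc.IH[OF that] that by (intro mult_mono) auto
          finally show ?thesis by (simp add: mult_ac)
        qed
      qed (use Suc.prems ab Gx G' in auto)
      then show ?case by (simp add: mult_ac)
    qed (simp add: G0)
    \<comment> \<open>Majorant of \<open>G1\<close> on the subinterval: |t - x0| is at most b - a,
      which leaves the exponential series at M (b - a), shifted by one.\<close>
    define B where "B n = (case n of 0 \<Rightarrow> 0 | Suc m \<Rightarrow> M * norm c * (inverse (fact m) * (M * (b - a)) ^ m))" for n
    have B: "summable B"
      using summable_mult[OF summable_exp[of "M * (b - a)"], of "M * norm c"]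
      by (subst summable_Suc_iff[symmetric]) (simp add: B_def)
    have G1_le: "norm (G1 n t) \<le> B n" if "t \<in> {a..b}" for n t
    proof (cases n)
      case (Suc m)
      have "norm (L t (G m t)) \<le> norm (L t) * norm (G m t)" by (rule norm_blinfun)
      also have "\<dots> \<le> M * (norm c * M ^ m / fact m * \<bar>t - x\<^sub>0\<bar> ^ m)"
        using M G_le[OF that] that by (intro mult_mono) auto
      also have "\<dots> \<le> M * (norm c * M ^ m / fact m * (b - a) ^ m)"
        using that ab M by (intro mult_left_mono power_mono) auto
      finally show ?thesis by (simp add: Suc G1_def B_def power_mult_distrib divide_inverse mult_ac)
    qed (simp add: G1_def B_def)
    have f': "(G n has_derivative (\<lambda>h. h *\<^sub>R G1 n t)) (at t within {a..b})" if "t \<in> {a..b}" for n t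
      using G1[of t n] that ab(5) has_derivative_at_withinI unfolding has_vector_derivative_def by blast
    have bound: "norm (h *\<^sub>R G1 n t) \<le> B n * norm h" if "t \<in> {a..b}" for n t and h :: real
      using mult_right_mono[OF G1_le[OF that, of n], of "\<bar>h\<bar>"] by (simp add: mult.commute)
    have sm0: "summable (\<lambda>n. G n x\<^sub>0)"
      using Gx by (subst summable_Suc_iff[symmetric]) simp
    have x: "x \<in> {a..b}" and x0: "x\<^sub>0 \<in> {a..b}" using ab by auto
    note * = has_derivative_suminf[OF convex_real_interval(5) f' bound B x0 sm0 x]
    have "(\<Sum>n. h *\<^sub>R G1 n x) = h *\<^sub>R L x (\<Sum>n. G n x)" for h
    proof -
      have "summable (\<lambda>n. L x (G n x))"
        by (rule bounded_linear.summable[OF blinfun.bounded_linear_right *(1)])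
      then have sm: "summable (\<lambda>n. G1 n x)"
        by (subst summable_Suc_iff[symmetric]) (simp add: G1_def)
      have "(\<Sum>n. G1 n x) = (\<Sum>n. L x (G n x))"
        using suminf_split_head[OF sm] by (simp add: G1_def)
      also have "\<dots> = L x (\<Sum>n. G n x)"
        by (rule bounded_linear.suminf[OF blinfun.bounded_linear_right *(1), symmetric])
      finally show ?thesis using suminf_scaleR_right[OF sm] by simp
    qed
    with *(2) show ?thesis
      using ab unfolding has_vector_derivative_def by (simp add: at_within_Icc_at)
  qed
  moreover have "(\<Sum>n. G n x\<^sub>0) = c"
    using suminf_finite[of "{0}" "\<lambda>n. G n x\<^sub>0"] Gx G0 by (metis finite.emptyI finite.insertI insertI1 not0_implies_Suc sum.empty sum.insert add.right_neutral empty_iff insertE)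
  ultimately show ?thesis by (intro that[of "\<lambda>x. \<Sum>n. G n x"]) auto
qed

section \<open>The differential of the matrix exponential\<close>

text \<open>Iterated left multiplication, as in the body of \<open>mexp\<close>, because
  \<open>^\<close> on this type is the entrywise power.\<close>

definition mpow :: "complex ^ 'n ^ 'n \<Rightarrow> nat \<Rightarrow> complex ^ 'n ^ 'n" where
  "mpow \<sigma> k = (((**) \<sigma>) ^^ k) (mat 1)"

lemma mpow_0 [simp]: "mpow \<sigma> 0 = mat 1"
  by (simp add: mpow_def)

lemma mpow_Suc: "mpow \<sigma> (Suc k) = \<sigma> ** mpow \<sigma> k"
  by (simp add: mpow_def)

lemma mpow_commute:
  assumes "X ** \<sigma> = \<sigma> ** X"
  shows "X ** mpow \<sigma> k = mpow \<sigma> k ** X"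
proof (induction k)
  case (Suc k)
  have "X ** mpow \<sigma> (Suc k) = \<sigma> ** (X ** mpow \<sigma> k)"
    using assms by (simp add: mpow_Suc matrix_mul_assoc)
  then show ?case using Suc by (simp add: mpow_Suc matrix_mul_assoc)
qed simp

text \<open>The factor \<open>norm (mat 1)\<close> remains because the Frobenius norm of the
  identity is the square root of n, not 1.\<close>

lemma norm_mpow_le: "norm (mpow \<sigma> k) \<le> norm \<sigma> ^ k * norm (mat 1 :: complex ^ 'n ^ 'n)"
  for \<sigma> :: "complex ^ 'n ^ 'n"
  unfolding mpow_def by (rule norm_funpow_le) (simp_all add: norm_matrix_mult_le)

lemma summable_norm_mpow: "summable (\<lambda>k. norm ((1 / fact k) *\<^sub>R mpow \<sigma> k))"
proof (rule summable_comparison_test')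
  show "summable (\<lambda>k. inverse (fact k) * norm \<sigma> ^ k * norm (mat 1 :: complex ^ 'a ^ 'a))"
    by (rule summable_mult2[OF summable_exp])
  show "norm (norm ((1 / fact k) *\<^sub>R mpow \<sigma> k))
      \<le> inverse (fact k) * norm \<sigma> ^ k * norm (mat 1 :: complex ^ 'a ^ 'a)" for k
    using norm_mpow_le[of \<sigma> k] by (simp add: field_simps)
qed

lemma mexp_mpow: "mexp \<sigma> = (\<Sum>k. (1 / fact k) *\<^sub>R mpow \<sigma> k)"
  by (simp add: mexp_def mpow_def)

lemma norm_ad_le: "norm (ad \<sigma> \<zeta>) \<le> 2 * norm \<sigma> * norm \<zeta>"
  using norm_triangle_ineq4[of "\<sigma> ** \<zeta>" "\<zeta> ** \<sigma>"] norm_matrix_mult_le[of \<sigma> \<zeta>]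
    norm_matrix_mult_le[of \<zeta> \<sigma>]
  unfolding ad_def by (simp add: mult_ac)

text \<open>The bound is uniform over \<open>norm \<sigma> \<le> r\<close>, which the continuity of
  \<open>dexp\<close> in \<sigma> requires. Weakening 1/(k+1)! to 1/k! leaves a plain exponential
  series.\<close>

lemma norm_dexp_term_le:
  assumes "norm \<sigma> \<le> r"
  shows "norm ((1 / fact (Suc k)) *\<^sub>R (ad \<sigma> ^^ k) \<zeta>) \<le> inverse (fact k) * (2 * r) ^ k * norm \<zeta>"
proof -
  have r: "r \<ge> 0" using assms norm_ge_zero[of \<sigma>] by linarith
  have "norm (ad \<sigma> y) \<le> 2 * r * norm y" for y
    using norm_ad_le[of \<sigma> y] mult_right_mono[OF assms norm_ge_zero[of y]] by simp
  then have "norm ((ad \<sigma> ^^ k) \<zeta>) \<le> (2 * r) ^ k * norm \<zeta>"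
    by (rule norm_funpow_le) (simp add: r)
  moreover have "1 / fact (Suc k) \<le> (inverse (fact k) :: real)"
    using fact_mono[of k "Suc k", where 'a = real]
    by (simp add: divide_simps del: fact_Suc)
  ultimately have "1 / fact (Suc k) * norm ((ad \<sigma> ^^ k) \<zeta>) \<le> inverse (fact k) * ((2 * r) ^ k * norm \<zeta>)"
    by (intro mult_mono) (auto simp del: fact_Suc)
  then show ?thesis by (simp add: mult.assoc del: fact_Suc)
qed

lemma summable_norm_dexp: "summable (\<lambda>k. norm ((1 / fact (Suc k)) *\<^sub>R (ad \<sigma> ^^ k) \<zeta>))"
  by (rule summable_comparison_test'[OF summable_mult2[OF summable_exp[of "2 * norm \<sigma>"], of "norm \<zeta>"]])
    (use norm_dexp_term_le[of \<sigma> "norm \<sigma>"] in simp)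

text \<open>The derivative of the k-th power at \<sigma> in direction h; the recursion is the
  Leibniz rule for \<sigma> times the k-th power.\<close>

primrec dpow :: "complex ^ 'n ^ 'n \<Rightarrow> complex ^ 'n ^ 'n \<Rightarrow> nat \<Rightarrow> complex ^ 'n ^ 'n" where
  "dpow \<sigma> h 0 = 0"
| "dpow \<sigma> h (Suc k) = h ** mpow \<sigma> k + \<sigma> ** dpow \<sigma> h k"

lemma has_derivative_mpow:
  "((\<lambda>\<sigma>. mpow \<sigma> k) has_derivative (\<lambda>h. dpow \<sigma> h k)) (at \<sigma> within S)"
proof (induction k)
  case (Suc k)
  from matmul.FDERIV[OF has_derivative_ident Suc] show ?case
    by (simp add: mpow_Suc add.commute)
qed simp

text \<open>The noncommutative form of k r^(k-1); the successor index avoids the exponent k - 1 at k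
  = 0.\<close>

lemma norm_dpow_le:
  fixes \<sigma> :: "complex ^ 'n ^ 'n"
  assumes r: "norm \<sigma> \<le> r"
  shows "norm (dpow \<sigma> h (Suc k)) \<le> real (Suc k) * r ^ k * norm (mat 1 :: complex ^ 'n ^ 'n) * norm h"
proof (induction k)
  case 0
  show ?case using norm_matrix_mult_le[of h "mat 1 :: complex ^ 'n ^ 'n"] by (simp add: mult.commute)
next
  case (Suc k)
  let ?c = "norm (mat 1 :: complex ^ 'n ^ 'n)"
  have r0: "0 \<le> r" using r norm_ge_zero[of \<sigma>] by linarith
  have "norm (mpow \<sigma> (Suc k)) \<le> r ^ Suc k * ?c"
    by (rule order_trans[OF norm_mpow_le mult_right_mono[OF power_mono[OF r]]]) simp_all
  then have 1: "norm (h ** mpow \<sigma> (Suc k)) \<le> norm h * (r ^ Suc k * ?c)"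
    by (intro order_trans[OF norm_matrix_mult_le] mult_left_mono) auto
  have 2: "norm (\<sigma> ** dpow \<sigma> h (Suc k)) \<le> r * (real (Suc k) * r ^ k * ?c * norm h)"
    using Suc r r0 by (intro order_trans[OF norm_matrix_mult_le] mult_mono) auto
  have "norm (dpow \<sigma> h (Suc (Suc k))) \<le> norm (h ** mpow \<sigma> (Suc k)) + norm (\<sigma> ** dpow \<sigma> h (Suc k))"
    by (subst dpow.simps(2)) (rule norm_triangle_ineq)
  also have "\<dots> \<le> norm h * (r ^ Suc k * ?c) + r * (real (Suc k) * r ^ k * ?c * norm h)"
    using 1 2 by (rule add_mono)
  also have "\<dots> = real (Suc (Suc k)) * r ^ Suc k * ?c * norm h"
    by (simp add: algebra_simps)
  finally show ?case .
qed

text \<open>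
  By Pascal's rule. Divided by \<open>(N + 1)!\<close>, the right-hand side is a term of the Cauchy product of
  the series of \<open>dexp \<sigma> h\<close> and \<open>mexp \<sigma>\<close>.
\<close>

lemma dpow_eq_sum_ad:
  "dpow \<sigma> h (Suc N) =
    (\<Sum>j\<le>N. real (Suc N choose Suc j) *\<^sub>R ((ad \<sigma> ^^ j) h ** mpow \<sigma> (N - j)))"
proof (induction N)
  case (Suc N)
  define T where "T j = (ad \<sigma> ^^ j) h ** mpow \<sigma> (Suc N - j)" for j
  \<comment> \<open>Moving \<sigma> past Y by \<sigma> Y = ad(Y) + Y \<sigma> yields one term with a
    further commutator and one with a further power of \<sigma>.\<close>
  have step: "\<sigma> ** ((ad \<sigma> ^^ j) h ** mpow \<sigma> (N - j)) = T (Suc j) + T j" if "j \<le> N" for j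
    using that by (simp add: T_def ad_def matmul.diff_left matrix_mul_assoc Suc_diff_le mpow_Suc)
  have "dpow \<sigma> h (Suc (Suc N)) = T 0 + (\<Sum>j\<le>N. real (Suc N choose Suc j) *\<^sub>R (T (Suc j) + T j))"
    by (subst dpow.simps(2), subst Suc)
      (simp add: T_def[of 0] matmul.sum_right matmul.scaleR_right step del: dpow.simps)
  also have "\<dots> = T 0 + (\<Sum>j\<le>N. real (Suc N choose Suc j) *\<^sub>R T (Suc j))
      + (\<Sum>j\<le>N. real (Suc N choose Suc j) *\<^sub>R T j)"
    by (simp add: scaleR_add_right sum.distrib)
  also have "T 0 + (\<Sum>j\<le>N. real (Suc N choose Suc j) *\<^sub>R T (Suc j))
      = (\<Sum>j\<le>Suc N. real (Suc N choose j) *\<^sub>R T j)"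
    by (subst sum.atMost_Suc_shift) simp
  \<comment> \<open>The term added at the top has binomial coefficient 0; it aligns the two ranges
    for Pascal's rule.\<close>
  also have "(\<Sum>j\<le>N. real (Suc N choose Suc j) *\<^sub>R T j)
      = (\<Sum>j\<le>Suc N. real (Suc N choose Suc j) *\<^sub>R T j)"
    by (simp add: binomial_eq_0 del: binomial_Suc_Suc)
  also have "(\<Sum>j\<le>Suc N. real (Suc N choose j) *\<^sub>R T j)
        + (\<Sum>j\<le>Suc N. real (Suc N choose Suc j) *\<^sub>R T j)
      = (\<Sum>j\<le>Suc N. real (Suc (Suc N) choose Suc j) *\<^sub>R T j)"
    unfolding sum.distrib[symmetric]
    by (rule sum.cong) (simp_all only: scaleR_add_left[symmetric] of_nat_add[symmetric] binomial_Suc_Suc[of "Suc N"])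
  finally show ?case by (simp add: T_def del: dpow.simps)
qed simp

text \<open>Each entry of the product is a finite sum of scalar Cauchy products, and entries inherit
  absolute convergence from the matrix norm.\<close>

lemma matrix_Cauchy_product_sums:
  fixes a :: "nat \<Rightarrow> complex ^ 'm ^ 'n" and b :: "nat \<Rightarrow> complex ^ 'p ^ 'm"
  assumes a: "summable (\<lambda>k. norm (a k))" and b: "summable (\<lambda>k. norm (b k))"
  shows "(\<lambda>k. \<Sum>i\<le>k. a i ** b (k - i)) sums ((\<Sum>k. a k) ** (\<Sum>k. b k))"
proof -
  have nth: "(\<Sum>k. f k) $ i $ j = (\<Sum>k. f k $ i $ j)" "summable (\<lambda>k. norm (f k $ i $ j))"
    if f: "summable (\<lambda>k. norm (f k))" for f :: "nat \<Rightarrow> complex ^ 'q ^ 'r" and i j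
  proof -
    have "bounded_linear (\<lambda>x :: complex ^ 'q ^ 'r. x $ i $ j)"
      by (rule bounded_linear_compose[OF bounded_linear_vec_nth bounded_linear_vec_nth])
    from bounded_linear.suminf[OF this summable_norm_cancel[OF f]]
    show "(\<Sum>k. f k) $ i $ j = (\<Sum>k. f k $ i $ j)" .
    have "norm (f k $ i $ j) \<le> norm (f k)" for k
      by (meson Finite_Cartesian_Product.norm_nth_le order_trans)
    then show "summable (\<lambda>k. norm (f k $ i $ j))"
      by (intro summable_comparison_test'[OF f]) simp
  qed
  have "(\<lambda>k. (\<Sum>i\<le>k. a i ** b (k - i)) $ p $ q) sums ((\<Sum>k. a k) ** (\<Sum>k. b k)) $ p $ q" for p q
  proof -
    have "(\<lambda>k. \<Sum>m\<in>UNIV. \<Sum>i\<le>k. a i $ p $ m * b (k - i) $ m $ q) sums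
        (\<Sum>m\<in>UNIV. (\<Sum>k. a k $ p $ m) * (\<Sum>k. b k $ m $ q))"
      by (intro sums_sum Cauchy_product_sums nth(2) a b)
    then show ?thesis
      unfolding matrix_matrix_mult_def by (simp add: nth(1)[OF a] nth(1)[OF b] sum.swap[of _ UNIV])
  qed
  then show ?thesis unfolding sums_def
    by (intro vec_tendstoI) (simp add: sum_component)
qed

lemma has_derivative_mexp: "(mexp has_derivative (\<lambda>h. dexp \<sigma> h ** mexp \<sigma>)) (at \<sigma>)"
  for \<sigma> :: "complex ^ 'n ^ 'n"
proof -
  \<comment> \<open>The additional 1 puts \<sigma> inside the open ball, so that the derivative
    within the ball is the full derivative.\<close>
  define r where "r = norm \<sigma> + 1"
  define c where "c = norm (mat 1 :: complex ^ 'n ^ 'n)"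
  \<comment> \<open>From k r^(k-1) / k! = r^(k-1) / (k-1)!; the power with exponent 0 is constant
    and contributes 0.\<close>
  define M where "M n = (case n of 0 \<Rightarrow> 0 | Suc m \<Rightarrow> inverse (fact m) * r ^ m * c)" for n
  let ?f' = "\<lambda>n \<sigma> h. (1 / fact n) *\<^sub>R dpow \<sigma> h n :: complex ^ 'n ^ 'n"
  have M: "summable M"
    using summable_mult2[OF summable_exp[of r], of c]
    by (subst summable_Suc_iff[symmetric]) (simp add: M_def)
  have bound: "norm (?f' n \<tau> h) \<le> M n * norm h" if "\<tau> \<in> ball 0 r" for n \<tau> h
  proof (cases n)
    case (Suc m)
    have "norm (dpow \<tau> h (Suc m)) \<le> real (Suc m) * r ^ m * c * norm h"
      unfolding c_def using that by (intro norm_dpow_le) simp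
    then have "norm (?f' (Suc m) \<tau> h) \<le> 1 / fact (Suc m) * (real (Suc m) * r ^ m * c * norm h)"
      by (simp add: divide_right_mono del: dpow.simps fact_Suc)
    also have "\<dots> = M n * norm h"
      by (simp add: M_def Suc divide_simps)
    finally show ?thesis by (simp only: Suc)
  qed (simp add: M_def)
  have f': "((\<lambda>\<tau>. (1 / fact n) *\<^sub>R mpow \<tau> n) has_derivative ?f' n \<tau>) (at \<tau> within ball 0 r)" for n \<tau>
    by (intro derivative_intros has_derivative_mpow)
  have sm: "summable (\<lambda>n. (1 / fact n) *\<^sub>R mpow \<sigma> n)"
    by (rule summable_norm_cancel[OF summable_norm_mpow])
  have \<sigma>: "\<sigma> \<in> ball 0 r" by (simp add: r_def)
  have "(mexp has_derivative (\<lambda>h. \<Sum>n. ?f' n \<sigma> h)) (at \<sigma> within ball 0 r)"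
    unfolding mexp_mpow by (rule has_derivative_suminf(2)[OF convex_ball f' bound M \<sigma> sm \<sigma>])
  moreover have "(\<Sum>n. ?f' n \<sigma> h) = dexp \<sigma> h ** mexp \<sigma>" for h
  proof -
    have term_eq: "?f' (Suc N) \<sigma> h = (\<Sum>j\<le>N. ((1 / fact (Suc j)) *\<^sub>R (ad \<sigma> ^^ j) h) ** ((1 / fact (N - j)) *\<^sub>R mpow \<sigma> (N - j)))" for N
      unfolding dpow_eq_sum_ad scaleR_sum_right
      by (rule sum.cong) (simp_all add: matmul.scaleR_left matmul.scaleR_right binomial_fact
          divide_simps del: fact_Suc binomial_Suc_Suc)
    have "(\<lambda>N. ?f' (Suc N) \<sigma> h) sums (dexp \<sigma> h ** mexp \<sigma>)"
      unfolding term_eq dexp_def mexp_mpow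
      by (rule matrix_Cauchy_product_sums[OF summable_norm_dexp summable_norm_mpow])
    then have "(\<lambda>n. ?f' n \<sigma> h) sums (dexp \<sigma> h ** mexp \<sigma>)"
      by (subst (asm) sums_Suc_iff) simp
    then show ?thesis by (rule sums_unique[symmetric])
  qed
  ultimately show ?thesis by (simp only: at_within_open[OF \<sigma> open_ball])
qed

section \<open>Properties of the exponential and of its trivialised differential\<close>

lemma linear_dexp: "linear (dexp \<sigma>)"
proof (rule linearI)
  have L: "linear (ad \<sigma> ^^ k)" for k
  proof (induction k)
    case (Suc k)
    then show ?case
      using linear_compose[OF Suc bounded_linear.linear[OF bounded_linear_ad]] by (simp add: o_def)
  qed (simp add: linear_id[unfolded id_def])
  show "dexp \<sigma> (x + y) = dexp \<sigma> x + dexp \<sigma> y" for x y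
    unfolding dexp_def
    by (simp add: linear_add[OF L] scaleR_add_right suminf_add[OF summable_dexp summable_dexp] del: fact_Suc)
  show "dexp \<sigma> (c *\<^sub>R x) = c *\<^sub>R dexp \<sigma> x" for c x
  proof -
    have "(1 / fact (Suc k)) *\<^sub>R (ad \<sigma> ^^ k) (c *\<^sub>R x) = c *\<^sub>R ((1 / fact (Suc k)) *\<^sub>R (ad \<sigma> ^^ k) x)" for k
      by (simp add: linear_cmul[OF L] del: fact_Suc)
    then show ?thesis unfolding dexp_def by (simp only: suminf_scaleR_right[OF summable_dexp])
  qed
qed

text \<open>Used at \<sigma> = 0, where it makes the derivative of the exponential the identity, and
  along rays t \<tau>, where it gives the usual derivative of a one-parameter group.\<close>

lemma dexp_commuting: "ad \<sigma> \<zeta> = 0 \<Longrightarrow> dexp \<sigma> \<zeta> = \<zeta>"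
proof -
  assume a: "ad \<sigma> \<zeta> = 0"
  have "(ad \<sigma> ^^ k) \<zeta> = 0" if "k \<noteq> 0" for k
    using that
  proof (induction k)
    case (Suc k)
    then show ?case using a by (cases "k = 0") (simp_all add: ad_def)
  qed simp
  then have "(\<Sum>k. (1 / fact (Suc k)) *\<^sub>R (ad \<sigma> ^^ k) \<zeta>) = (\<Sum>k\<in>{0}. (1 / fact (Suc k)) *\<^sub>R (ad \<sigma> ^^ k) \<zeta>)"
    by (intro suminf_finite) auto
  then show ?thesis by (simp add: dexp_def)
qed

lemma mexp_0: "mexp 0 = mat 1"
proof -
  have "mpow 0 k = (0 :: complex ^ 'a ^ 'a)" if "k \<noteq> 0" for k
    using that by (cases k) (simp_all add: mpow_Suc)
  then have "(\<Sum>k. (1 / fact k) *\<^sub>R mpow 0 k) = (\<Sum>k\<in>{0}. (1 / fact k) *\<^sub>R mpow 0 k :: complex ^ 'a ^ 'a)"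
    by (intro suminf_finite) auto
  then show ?thesis by (simp add: mexp_mpow)
qed

lemma mexp_commute:
  assumes "X ** \<sigma> = \<sigma> ** X"
  shows "X ** mexp \<sigma> = mexp \<sigma> ** X"
proof -
  note sm = summable_norm_cancel[OF summable_norm_mpow[of \<sigma>]]
  show ?thesis
    unfolding mexp_mpow
    by (simp add: bounded_linear.suminf[OF matmul.bounded_linear_right sm]
        bounded_linear.suminf[OF matmul.bounded_linear_left sm]
        matmul.scaleR_left matmul.scaleR_right mpow_commute[OF assms])
qed

lemma has_vector_derivative_mexp:
  assumes "(\<sigma> has_vector_derivative \<sigma>') (at x within S)"
  shows "((\<lambda>x. mexp (\<sigma> x)) has_vector_derivative dexp (\<sigma> x) \<sigma>' ** mexp (\<sigma> x)) (at x within S)"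
  using vector_derivative_diff_chain_within[OF assms has_derivative_at_withinI[OF has_derivative_mexp]]
  by (simp add: o_def)

text \<open>The product of exp(-t \<sigma>) and exp(t \<sigma>) has derivative 0 because \<sigma>
  commutes with both factors; its values at t = 0 and t = 1 therefore agree.\<close>

lemma mexp_minus_mult: "mexp (- \<sigma>) ** mexp \<sigma> = mat 1"
proof -
  define f where "f t = mexp (t *\<^sub>R (- \<sigma>)) ** mexp (t *\<^sub>R \<sigma>)" for t :: real
  have d: "((\<lambda>t. mexp (t *\<^sub>R \<tau>)) has_vector_derivative \<tau> ** mexp (t *\<^sub>R \<tau>)) (at t)"
    for t and \<tau> :: "complex ^ 'a ^ 'a"
  proof -
    have "((\<lambda>t. t *\<^sub>R \<tau>) has_vector_derivative \<tau>) (at t)"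
      by (auto intro!: derivative_eq_intros)
    moreover have "ad (t *\<^sub>R \<tau>) \<tau> = 0"
      by (simp add: ad_def matmul.scaleR_left matmul.scaleR_right)
    ultimately show ?thesis
      using has_vector_derivative_mexp[of "\<lambda>t. t *\<^sub>R \<tau>" \<tau> t UNIV] by (simp add: dexp_commuting)
  qed
  have "(f has_vector_derivative 0) (at t)" for t
  proof -
    have "\<sigma> ** mexp (t *\<^sub>R (- \<sigma>)) = mexp (t *\<^sub>R (- \<sigma>)) ** \<sigma>"
      by (intro mexp_commute) (simp add: matmul.scaleR_left matmul.scaleR_right matmul.minus_left matmul.minus_right)
    then show ?thesis
      using matmul.has_vector_derivative[OF d[of "- \<sigma>" t] d[of \<sigma> t]]
      by (simp add: f_def[abs_def] matrix_mul_assoc matmul.minus_left)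
  qed
  then obtain c where "\<And>t. f t = c"
    using has_vector_derivative_zero_constant[of UNIV f] by auto
  then have "f 1 = f 0" by simp
  then show ?thesis by (simp add: f_def mexp_0)
qed

text \<open>The adjoint reverses products, which is harmless for powers of a single matrix.\<close>

lemma dagger_mexp: "dagger (mexp \<sigma>) = mexp (dagger \<sigma>)"
proof -
  have "dagger (mpow \<sigma> k) = mpow (dagger \<sigma>) k" for k
  proof (induction k)
    case (Suc k)
    then show ?case
      using mpow_commute[of "dagger \<sigma>" "dagger \<sigma>" k] by (simp add: mpow_Suc dagger_mult)
  qed simp
  then show ?thesis
    unfolding mexp_mpow
    by (subst bounded_linear.suminf[OF bounded_linear_dagger summable_norm_cancel[OF summable_norm_mpow]])
      (simp add: linear_cmul[OF bounded_linear.linear[OF bounded_linear_dagger]])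
qed

lemma mexp_unitary: "\<sigma> \<in> unitary_algebra \<Longrightarrow> mexp \<sigma> \<in> unitary_group"
  by (simp add: unitary_algebra_def unitary_group_iff dagger_mexp mexp_minus_mult)

text \<open>Commutators of anti-Hermitian matrices are anti-Hermitian, and the coefficients of the
  series are real.\<close>

lemma dexp_unitary_algebra:
  assumes \<sigma>: "\<sigma> \<in> unitary_algebra" and \<zeta>: "\<zeta> \<in> unitary_algebra"
  shows "dexp \<sigma> \<zeta> \<in> unitary_algebra"
proof -
  have "dagger ((ad \<sigma> ^^ k) \<zeta>) = - (ad \<sigma> ^^ k) \<zeta>" for k
  proof (induction k)
    case (Suc k)
    then show ?case using \<sigma>
      by (simp add: ad_def unitary_algebra_def dagger_diff dagger_mult matmul.minus_left matmul.minus_right)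
  qed (use \<zeta> in \<open>simp add: unitary_algebra_def\<close>)
  then show ?thesis
    unfolding dexp_def unitary_algebra_def
    by (simp add: bounded_linear.suminf[OF bounded_linear_dagger summable_dexp]
        linear_cmul[OF bounded_linear.linear[OF bounded_linear_dagger]]
        suminf_minus[OF summable_dexp] del: fact_Suc)
qed

text \<open>Continuity for each fixed direction is enough: in finite dimension it gives continuity
  of the derivative of \<open>mexp\<close> as an operator, the input of the inverse function
  theorem.\<close>

lemma isCont_dexp: "isCont (\<lambda>\<sigma>. dexp \<sigma> \<zeta>) \<sigma>"
proof -
  define r where "r = norm \<sigma> + 1"
  have term_cont: "continuous_on S (\<lambda>\<sigma>. (ad \<sigma> ^^ k) \<zeta>)" for k S
    by (induction k) (auto simp: ad_def intro!: continuous_intros matmul.continuous_on)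
  have "uniform_limit (ball 0 r) (\<lambda>n \<tau>. \<Sum>k<n. (1 / fact (Suc k)) *\<^sub>R (ad \<tau> ^^ k) \<zeta>)
      (\<lambda>\<tau>. dexp \<tau> \<zeta>) sequentially"
    unfolding dexp_def
    by (rule Weierstrass_m_test[OF norm_dexp_term_le[where r = r] summable_mult2[OF summable_exp]]) auto
  moreover have "\<forall>\<^sub>F n in sequentially.
      continuous_on (ball 0 r) (\<lambda>\<tau>. \<Sum>k<n. (1 / fact (Suc k)) *\<^sub>R (ad \<tau> ^^ k) \<zeta>)"
    by (intro always_eventually allI continuous_intros term_cont)
  ultimately have "continuous_on (ball 0 r) (\<lambda>\<tau>. dexp \<tau> \<zeta>)"
    by (intro uniform_limit_theorem[where F = sequentially]) auto
  then show ?thesis by (rule continuous_on_interior) (simp add: r_def)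
qed

section \<open>The Cayley transform\<close>

text \<open>In this form the limit laws for products apply directly to the difference quotient of an
  inverse matrix.\<close>

lemma has_vector_derivative_iff_tendsto:
  fixes f :: "real \<Rightarrow> 'a::real_normed_vector"
  shows "(f has_vector_derivative D) (at x) \<longleftrightarrow> ((\<lambda>y. (f y - f x) /\<^sub>R (y - x)) \<longlongrightarrow> D) (at x)"
proof -
  have "norm ((1 / norm (y - x)) *\<^sub>R (f y - (f x + (y - x) *\<^sub>R D))) = norm ((f y - f x) /\<^sub>R (y - x) - D)"
    if "y \<noteq> x" for y
  proof -
    have "f y - (f x + (y - x) *\<^sub>R D) = (y - x) *\<^sub>R ((f y - f x) /\<^sub>R (y - x) - D)"
      using that by (simp add: scaleR_diff_right)
    then show ?thesis using that by simp
  qed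
  then have "((\<lambda>y. norm ((1 / norm (y - x)) *\<^sub>R (f y - (f x + (y - x) *\<^sub>R D)))) \<longlongrightarrow> 0) (at x)
      \<longleftrightarrow> ((\<lambda>y. norm ((f y - f x) /\<^sub>R (y - x) - D)) \<longlongrightarrow> 0) (at x)"
    by (intro tendsto_cong) (simp add: eventually_at_filter)
  then show ?thesis
    unfolding has_vector_derivative_def has_derivative_within tendsto_norm_zero_iff LIM_zero_iff
    by (simp add: bounded_linear_scaleR_left)
qed

text \<open>The resolvent identity N(y) - N(x) = -N(y) (M(y) - M(x)) N(x) is used twice: for the
  continuity of N at x, and, divided by y - x, for the derivative.\<close>

lemma has_vector_derivative_matrix_inverse:
  fixes M N :: "real \<Rightarrow> complex ^ 'n ^ 'n"
  assumes S: "open S" "x \<in> S" and MN: "\<And>y. y \<in> S \<Longrightarrow> M y ** N y = mat 1"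
    and M': "(M has_vector_derivative M') (at x)"
  shows "(N has_vector_derivative - (N x ** M' ** N x)) (at x)"
proof -
  have NM: "N y ** M y = mat 1" if "y \<in> S" for y
    using MN[OF that] matrix_left_right_inverse by blast
  have diff: "N y - N x = - (N y ** (M y - M x) ** N x)" if "y \<in> S" for y
    using NM[OF that] MN[OF S(2)]
    by (simp add: matmul.diff_left matmul.diff_right matrix_mul_assoc[symmetric])
  \<comment> \<open>Once |M(y) - M(x)| a < 1/2, the identity gives |N(y) - N(x)| \<le> |N(y)| / 2
    and hence |N(y)| \<le> 2 a, so the inverse stays bounded near x.\<close>
  define a where "a = norm (N x)"
  have Mc: "((\<lambda>y. norm (M y - M x)) \<longlongrightarrow> 0) (at x)"
    using has_vector_derivative_continuous[OF M'] by (simp add: isCont_def LIM_zero tendsto_norm_zero)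
  have "\<forall>\<^sub>F y in at x. norm (M y - M x) * a < 1 / 2"
    using tendsto_mult_left_zero[OF Mc] by (rule order_tendstoD) simp
  moreover have "\<forall>\<^sub>F y in at x. y \<in> S" using S by (simp add: eventually_at_in_open')
  ultimately have "\<forall>\<^sub>F y in at x. norm (N y - N x) \<le> 2 * a * a * norm (M y - M x)"
  proof eventually_elim
    case (elim y)
    have le: "norm (N y - N x) \<le> norm (N y) * norm (M y - M x) * a"
      unfolding diff[OF elim(2)] norm_minus_cancel a_def
      by (intro order_trans[OF norm_matrix_mult_le] mult_right_mono norm_matrix_mult_le norm_ge_zero)
    also have "\<dots> \<le> norm (N y) * (1 / 2)"
      using mult_left_mono[OF less_imp_le[OF elim(1)], of "norm (N y)"] by (simp add: mult.assoc)
    finally have "norm (N y) \<le> 2 * a"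
      using norm_triangle_ineq2[of "N y" "N x"] unfolding a_def by linarith
    then have "norm (N y) * norm (M y - M x) * a \<le> 2 * a * norm (M y - M x) * a"
      by (intro mult_right_mono) (simp_all add: a_def)
    with le show ?case by (simp add: mult_ac)
  qed
  moreover have "((\<lambda>y. 2 * a * a * norm (M y - M x)) \<longlongrightarrow> 0) (at x)"
    using Mc by (rule tendsto_mult_right_zero)
  ultimately have "((\<lambda>y. N y - N x) \<longlongrightarrow> 0) (at x)"
    by (rule Lim_null_comparison)
  then have N: "(N \<longlongrightarrow> N x) (at x)" by (simp add: LIM_zero_iff)
  have "((\<lambda>y. - (N y ** ((M y - M x) /\<^sub>R (y - x)) ** N x)) \<longlongrightarrow> - (N x ** M' ** N x)) (at x)"
    using M' unfolding has_vector_derivative_iff_tendsto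
    by (intro tendsto_minus matmul.tendsto N tendsto_const)
  moreover have "\<forall>\<^sub>F y in at x. - (N y ** ((M y - M x) /\<^sub>R (y - x)) ** N x) = (N y - N x) /\<^sub>R (y - x)"
    using S by (intro eventually_mono[OF eventually_at_in_open'[of S x]])
      (simp_all add: diff matmul.scaleR_left matmul.scaleR_right)
  ultimately show ?thesis
    unfolding has_vector_derivative_iff_tendsto by (rule Lim_transform_eventually)
qed

abbreviation cayley_denom :: "real ^ 'n ^ 'n \<Rightarrow> complex ^ 'n ^ 'n" where
  "cayley_denom s \<equiv> mat 1 + cscale \<i> (cmat_of_real s)"

text \<open>Pairing (1 + i s) v = 0 with v gives |v|^2 + i q = 0, where q = v^dagger s v is real by
  the symmetry of s. The real part forces v = 0.\<close>

lemma invertible_cayley_denom: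
  fixes s :: "real ^ 'n ^ 'n"
  assumes s: "transpose s = s"
  shows "cayley_denom s ** matrix_inv (cayley_denom s) = mat 1"
    and "matrix_inv (cayley_denom s) ** cayley_denom s = mat 1"
proof -
  have sym: "s $ j $ i = s $ i $ j" for i j
    using s by (metis transpose_def vec_lambda_beta)
  have "v = 0" if v: "cayley_denom s *v v = 0" for v :: "complex ^ 'n"
  proof -
    define q where "q = (\<Sum>i\<in>UNIV. \<Sum>j\<in>UNIV. cnj (v $ i) * (of_real (s $ i $ j) * v $ j))"
    have "cnj q = (\<Sum>i\<in>UNIV. \<Sum>j\<in>UNIV. v $ i * (of_real (s $ i $ j) * cnj (v $ j)))"
      by (simp add: q_def)
    also have "\<dots> = q"
      unfolding q_def by (subst sum.swap) (simp add: sym mult_ac)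
    finally have "Im q = 0" by (simp add: complex_eq_iff)
    have "v $ i + \<i> * (\<Sum>j\<in>UNIV. of_real (s $ i $ j) * v $ j) = 0" for i
    proof -
      have "(cayley_denom s *v v) $ i = v $ i + \<i> * (\<Sum>j\<in>UNIV. of_real (s $ i $ j) * v $ j)"
        by (simp add: matrix_vector_mult_add_rdistrib matrix_vector_mult_def[of "cscale \<i> _"] cmat_of_real_def
            sum_distrib_left mult.assoc)
      then show ?thesis using v by simp
    qed
    then have "0 = (\<Sum>i\<in>UNIV. cnj (v $ i) * (v $ i + \<i> * (\<Sum>j\<in>UNIV. of_real (s $ i $ j) * v $ j)))"
      by simp
    also have "\<dots> = (\<Sum>i\<in>UNIV. cnj (v $ i) * v $ i) + \<i> * q"
      by (simp add: q_def distrib_left sum.distrib sum_distrib_left mult_ac)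
    finally have "Re (\<Sum>i\<in>UNIV. cnj (v $ i) * v $ i) = 0"
      using \<open>Im q = 0\<close> by (metis Re_complex_of_real Re_i_times add.right_neutral minus_zero plus_complex.sel(1) zero_complex.sel(1))
    then have "(\<Sum>i\<in>UNIV. (cmod (v $ i))\<^sup>2) = 0"
      by (simp add: cmod_power2 flip: power2_eq_square)
    then show "v = 0" by (simp add: sum_nonneg_eq_0_iff vec_eq_iff)
  qed
  then obtain B where B: "B ** cayley_denom s = mat 1"
    using matrix_left_invertible_ker by blast
  then have "cayley_denom s ** B = mat 1" using matrix_left_right_inverse by blast
  with B have "\<exists>B. cayley_denom s ** B = mat 1 \<and> B ** cayley_denom s = mat 1" by blast
  \<comment> \<open>\<open>matrix_inv\<close> is a choice among two-sided inverses, so their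
    existence is what specifies it.\<close>
  from someI_ex[OF this]
  show "cayley_denom s ** matrix_inv (cayley_denom s) = mat 1"
    "matrix_inv (cayley_denom s) ** cayley_denom s = mat 1"
    unfolding matrix_inv_def by blast+
qed

lemma cayley_eq:
  assumes "transpose s = s"
  shows "cayley s = 2 *\<^sub>R matrix_inv (cayley_denom s) - mat 1"
proof -
  have "cayley s = (2 *\<^sub>R mat 1 - cayley_denom s) ** matrix_inv (cayley_denom s)"
    unfolding cayley_def by (simp add: scaleR_2)
  then show ?thesis
    using invertible_cayley_denom(1)[OF assms] by (simp add: matmul.diff_left matmul.scaleR_left)
qed

lemma cayley_mult_denom:
  assumes "transpose s = s"
  shows "cayley s ** cayley_denom s = mat 1 - cscale \<i> (cmat_of_real s)"
    and "cayley_denom s ** cayley s = mat 1 - cscale \<i> (cmat_of_real s)"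
  using invertible_cayley_denom[OF assms]
  by (simp_all add: cayley_eq[OF assms] matmul.diff_left matmul.diff_right matmul.scaleR_left
      matmul.scaleR_right) (simp_all add: scaleR_2)

text \<open>The numerator 1 - i s is the adjoint of P = 1 + i s and commutes with it. Symmetry holds
  because the inverse of a symmetric matrix is symmetric.\<close>

lemma cayley_unitary_sym:
  assumes s: "transpose s = s"
  shows "cayley s \<in> unitary_sym"
proof -
  define P where "P = cayley_denom s"
  define Q where "Q = matrix_inv P"
  note PQ = invertible_cayley_denom[OF s, folded P_def, folded Q_def]
  have "dagger (cmat_of_real s) = cmat_of_real s"
    by (simp add: dagger_def transpose_cmat_of_real s)
  then have dP: "dagger P = mat 1 - cscale \<i> (cmat_of_real s)"
    by (simp add: P_def dagger_add dagger_cscale) (simp add: vec_eq_iff)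
  have tP: "transpose P = P"
    by (simp add: P_def transpose_add transpose_cscale transpose_cmat_of_real s)
  have comm: "P ** dagger P = dagger P ** P"
    unfolding dP unfolding P_def
    by (simp add: matmul.add_left matmul.add_right matmul.diff_left matmul.diff_right)
  have dPQ: "dagger Q ** dagger P = mat 1"
    using PQ(1) dagger_mult[of P Q] by simp
  have "dagger (cayley s) ** cayley s = dagger Q ** (P ** dagger P) ** Q"
    unfolding cayley_def P_def[symmetric] Q_def[symmetric] dP[symmetric]
    by (simp add: dagger_mult matrix_mul_assoc)
  also have "\<dots> = (dagger Q ** dagger P) ** (P ** Q)"
    unfolding comm by (simp add: matrix_mul_assoc)
  finally have "cayley s \<in> unitary_group"
    by (simp add: unitary_group_iff dPQ PQ)
  moreover have "transpose Q = Q"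
  proof -
    have "transpose Q ** P = mat 1"
      using PQ(1) matrix_transpose_mul[of P Q] by (simp add: tP)
    then have "transpose Q ** (P ** Q) = Q"
      by (simp add: matrix_mul_assoc)
    then show ?thesis by (simp add: PQ)
  qed
  then have "transpose (cayley s) = cayley s"
    by (simp add: cayley_eq[OF s] P_def[symmetric] Q_def[symmetric] transpose_diff
        linear_cmul[OF bounded_linear.linear[OF bounded_linear_transpose]])
  ultimately show ?thesis by (simp add: unitary_sym_def)
qed

text \<open>Multiplication by P on both sides clears all inverses, since u P = P u = 1 - i s. The
  factor -2 i is the one in the derivative of the Cayley transform.\<close>

lemma cayley_riccati_field:
  assumes s: "transpose s = s"
  defines "P \<equiv> cayley_denom s"
  shows "P ** riccati_field A (cayley s) ** P = cscale (- 2 * \<i>) (cmat_of_real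
    (block_c A + block_d A ** s - s ** (block_a A + block_b A ** s)))"
proof -
  define a b c d \<sigma> where defs: "a = cmat_of_real (block_a A)" "b = cmat_of_real (block_b A)"
    "c = cmat_of_real (block_c A)" "d = cmat_of_real (block_d A)" "\<sigma> = cmat_of_real s"
  have real [simp]: "conj_mat a = a" "conj_mat b = b" "conj_mat c = c" "conj_mat d = d"
    by (simp_all add: defs)
  note m = cayley_mult_denom[OF s, folded P_def defs(5)]
  have "P ** riccati_field A (cayley s) ** P =
      P ** riccati_C A ** P + P ** riccati_D A ** (cayley s ** P)
      - (P ** cayley s) ** conj_mat (riccati_D A) ** P
      - (P ** cayley s) ** conj_mat (riccati_C A) ** (cayley s ** P)"
    unfolding riccati_field_def
    by (simp add: matmul.diff_left matmul.diff_right matmul.add_left matmul.add_right matrix_mul_assoc)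
  also have "\<dots> = cscale (- 2 * \<i>) (c + d ** \<sigma> - \<sigma> ** (a + b ** \<sigma>))"
    \<comment> \<open>After expansion only a linear identity between matrix products remains, so
      arithmetic on entries settles it although the factors do not commute.\<close>
    unfolding m unfolding P_def riccati_C_def riccati_D_def defs[symmetric]
    by (simp add: matmul.diff_left matmul.diff_right matmul.add_left matmul.add_right
        conj_mat_cscale conj_mat_diff conj_mat_add cscale_mult_left cscale_mult_right
        cscale_add cscale_diff matrix_mul_assoc)
      (simp add: vec_eq_iff algebra_simps)
  finally show ?thesis
    by (simp add: defs cmat_of_real_add cmat_of_real_diff cmat_of_real_mult)
qed

lemma real_riccati_flow_on_iff_cayley:
  fixes A :: "real \<Rightarrow> real ^ ('n::finite + 'n) ^ ('n + 'n)"
  assumes J: "open J" and s: "\<And>x. x \<in> J \<Longrightarrow> transpose (s x) = s x"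
  shows "real_riccati_flow_on J A s \<longleftrightarrow> riccati_flow_on J A (\<lambda>x. cayley (s x))"
proof -
  define P where "P x = cayley_denom (s x)" for x
  define Q where "Q x = matrix_inv (P x)" for x
  define F where "F x = block_c (A x) + block_d (A x) ** s x - s x ** (block_a (A x) + block_b (A x) ** s x)" for x
  have PQ: "P x ** Q x = mat 1" "Q x ** P x = mat 1" if "x \<in> J" for x
    unfolding Q_def P_def by (rule invertible_cayley_denom[OF s[OF that]])+
  have u: "cayley (s x) = 2 *\<^sub>R Q x - mat 1" if "x \<in> J" for x
    unfolding Q_def P_def by (rule cayley_eq[OF s[OF that]])
  have PfP: "P x ** riccati_field (A x) (cayley (s x)) ** P x = cscale (- 2 * \<i>) (cmat_of_real (F x))"
    if "x \<in> J" for x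
    unfolding P_def F_def by (rule cayley_riccati_field[OF s[OF that]])
  have "(s has_vector_derivative F x) (at x) \<longleftrightarrow>
      ((\<lambda>x. cayley (s x)) has_vector_derivative riccati_field (A x) (cayley (s x))) (at x)"
    if x: "x \<in> J" for x
  proof
    assume "(s has_vector_derivative F x) (at x)"
    then have "(P has_vector_derivative 0 + cscale \<i> (cmat_of_real (F x))) (at x)"
      unfolding P_def
      by (intro has_vector_derivative_add has_vector_derivative_const
          bounded_linear.has_vector_derivative[OF bounded_linear_cscale]
          bounded_linear.has_vector_derivative[OF bounded_linear_cmat_of_real])
    then have "(P has_vector_derivative cscale \<i> (cmat_of_real (F x))) (at x)" by simp
    with has_vector_derivative_matrix_inverse[OF J x, of P Q] PQ(1)
    have "(Q has_vector_derivative - (Q x ** cscale \<i> (cmat_of_real (F x)) ** Q x)) (at x)"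
      by blast
    then have "((\<lambda>x. 2 *\<^sub>R Q x - mat 1) has_vector_derivative
        2 *\<^sub>R (- (Q x ** cscale \<i> (cmat_of_real (F x)) ** Q x)) - 0) (at x)"
      by (intro has_vector_derivative_diff has_vector_derivative_const
          bounded_linear.has_vector_derivative[OF bounded_linear_scaleR_right])
    moreover have "2 *\<^sub>R (- (Q x ** cscale \<i> (cmat_of_real (F x)) ** Q x)) - 0
        = Q x ** cscale (- 2 * \<i>) (cmat_of_real (F x)) ** Q x"
      by (simp add: cscale_mult_left cscale_mult_right vec_eq_iff scaleR_conv_of_real[where 'a = complex])
    moreover have "\<dots> = (Q x ** P x) ** riccati_field (A x) (cayley (s x)) ** (P x ** Q x)"
      unfolding PfP[OF x, symmetric] by (simp add: matrix_mul_assoc)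
    ultimately have "((\<lambda>x. 2 *\<^sub>R Q x - mat 1) has_vector_derivative riccati_field (A x) (cayley (s x))) (at x)"
      by (simp add: PQ[OF x])
    then show "((\<lambda>x. cayley (s x)) has_vector_derivative riccati_field (A x) (cayley (s x))) (at x)"
      by (rule has_vector_derivative_transform_within_open[OF _ J x]) (simp add: u)
  next
    let ?f = "riccati_field (A x) (cayley (s x))"
    assume "((\<lambda>x. cayley (s x)) has_vector_derivative ?f) (at x)"
    \<comment> \<open>Half of u plus the identity is Q, the inverse of P; the rule for inverses is
      now applied with P and Q exchanged.\<close>
    then have "((\<lambda>x. (1/2) *\<^sub>R (cayley (s x) + mat 1)) has_vector_derivative (1/2) *\<^sub>R (?f + 0)) (at x)"
      by (intro has_vector_derivative_add has_vector_derivative_const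
          bounded_linear.has_vector_derivative[OF bounded_linear_scaleR_right])
    then have "(Q has_vector_derivative (1/2) *\<^sub>R (?f + 0)) (at x)"
      by (rule has_vector_derivative_transform_within_open[OF _ J x]) (simp add: u)
    with has_vector_derivative_matrix_inverse[OF J x, of Q P] PQ(2)
    have "(P has_vector_derivative - (P x ** ((1/2) *\<^sub>R (?f + 0)) ** P x)) (at x)"
      by blast
    moreover have "- (P x ** ((1/2) *\<^sub>R (?f + 0)) ** P x) = cscale \<i> (cmat_of_real (F x))"
      by (simp add: matmul.scaleR_left matmul.scaleR_right PfP[OF x])
        (simp add: vec_eq_iff scaleR_conv_of_real[where 'a = complex])
    ultimately have P': "(P has_vector_derivative cscale \<i> (cmat_of_real (F x))) (at x)" by simp
    \<comment> \<open>The entrywise imaginary part is real-linear and recovers s from P, the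
      identity matrix being real.\<close>
    have "linear (map_matrix Im :: complex ^ 'n ^ 'n \<Rightarrow> _)"
      by (rule linearI) (simp_all add: vec_eq_iff)
    then have "bounded_linear (map_matrix Im :: complex ^ 'n ^ 'n \<Rightarrow> _)"
      by (rule linear_conv_bounded_linear[THEN iffD1])
    from bounded_linear.has_vector_derivative[OF this P']
    have "((\<lambda>y. map_matrix Im (P y)) has_vector_derivative map_matrix Im (cscale \<i> (cmat_of_real (F x)))) (at x)" .
    moreover have "map_matrix Im (P y) = s y" for y
      by (simp add: P_def cmat_of_real_def vec_eq_iff mat_def)
    moreover have "map_matrix Im (cscale \<i> (cmat_of_real (F x))) = F x"
      by (simp add: cmat_of_real_def vec_eq_iff)
    ultimately show "(s has_vector_derivative F x) (at x)" by simp
  qed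
  then show ?thesis
    using s cayley_unitary_sym unfolding real_riccati_flow_on_def riccati_flow_on_def F_def by blast
qed

section \<open>Pulling the flow back\<close>

text \<open>The product rule gives \<xi> u + u \<xi>^T, and anti-Hermiticity turns \<xi>^T into
  -conj(\<xi>).\<close>

lemma unitary_flow_imp_riccati_flow:
  assumes A: "\<forall>x\<in>J. A x \<in> sp_algebra" and u\<^sub>0: "u\<^sub>0 \<in> unitary_sym"
    and g: "unitary_flow_on J A u\<^sub>0 g"
  shows "riccati_flow_on J A (\<lambda>x. g x ** u\<^sub>0 ** transpose (g x))"
  unfolding riccati_flow_on_def
proof (intro ballI conjI)
  fix x assume x: "x \<in> J"
  let ?u = "g x ** u\<^sub>0 ** transpose (g x)"
  let ?\<xi> = "riccati_xi (A x) ?u"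
  have gx: "g x \<in> unitary_group" and g': "(g has_vector_derivative ?\<xi> ** g x) (at x)"
    using g x by (auto simp: unitary_flow_on_def)
  show u: "?u \<in> unitary_sym" by (rule unitary_sym_action[OF gx u\<^sub>0])
  have "?\<xi> \<in> unitary_algebra" using riccati_xi_antihermitian A x u by blast
  then have t: "transpose ?\<xi> = - conj_mat ?\<xi>"
    unfolding unitary_algebra_def by (simp add: dagger_def conj_mat_def transpose_def vec_eq_iff)
  have "((\<lambda>x. g x ** u\<^sub>0) has_vector_derivative g x ** 0 + ?\<xi> ** g x ** u\<^sub>0) (at x)"
    by (rule matmul.has_vector_derivative[OF g' has_vector_derivative_const])
  from matmul.has_vector_derivative[OF this
      bounded_linear.has_vector_derivative[OF bounded_linear_transpose g']]
  have "((\<lambda>x. g x ** u\<^sub>0 ** transpose (g x)) has_vector_derivative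
      g x ** u\<^sub>0 ** transpose (?\<xi> ** g x) + (g x ** 0 + ?\<xi> ** g x ** u\<^sub>0) ** transpose (g x)) (at x)" .
  moreover have "g x ** u\<^sub>0 ** transpose (?\<xi> ** g x) + (g x ** 0 + ?\<xi> ** g x ** u\<^sub>0) ** transpose (g x)
      = riccati_field (A x) ?u"
    using riccati_field_xi[OF _ u, of "A x"] A x
    by (simp add: matrix_transpose_mul t matmul.minus_left matmul.minus_right matrix_mul_assoc)
  ultimately show "((\<lambda>x. g x ** u\<^sub>0 ** transpose (g x)) has_vector_derivative riccati_field (A x) ?u) (at x)"
    by simp
qed

lemma constant_on_interval:
  fixes f :: "real \<Rightarrow> 'a::real_normed_vector"
  assumes "is_interval J" "\<And>x. x \<in> J \<Longrightarrow> (f has_vector_derivative 0) (at x)" "x \<in> J" "y \<in> J"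
  shows "f x = f y"
  using has_vector_derivative_zero_constant[of J f] assms
  by (metis has_vector_derivative_at_within is_interval_convex)

lemma continuous_on_riccati_xi:
  assumes "continuous_on J A" "continuous_on J u"
  shows "continuous_on J (\<lambda>x. riccati_xi (A x) (u x))"
proof -
  note cont = bounded_linear.continuous_on[OF bounded_linear_cscale]
    bounded_linear.continuous_on[OF bounded_linear_conj_mat]
    bounded_linear.continuous_on[OF bounded_linear_dagger]
    bounded_linear.continuous_on[OF bounded_linear_cmat_of_real]
  have block: "continuous_on J (\<lambda>x. block_a (A x))" "continuous_on J (\<lambda>x. block_b (A x))"
      "continuous_on J (\<lambda>x. block_c (A x))" "continuous_on J (\<lambda>x. block_d (A x))"
    unfolding block_a_def block_b_def block_c_def block_d_def
    by (intro continuous_on_vec_lambda continuous_on_component assms(1))+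
  show ?thesis
    unfolding riccati_xi_def riccati_C_def riccati_D_def
    by (intro continuous_on_diff continuous_on_add cont matmul.continuous_on block assms(2))
qed

lemma riccati_flow_imp_unitary_flow:
  fixes A :: "real \<Rightarrow> real ^ ('n::finite + 'n) ^ ('n + 'n)"
  assumes J: "open J" "is_interval J" "x\<^sub>0 \<in> J" and A: "\<forall>x\<in>J. A x \<in> sp_algebra"
    and A_cont: "continuous_on J A" and u: "riccati_flow_on J A u"
  obtains g where "unitary_flow_on J A (u x\<^sub>0) g" "g x\<^sub>0 = mat 1"
    "\<And>x. x \<in> J \<Longrightarrow> u x = g x ** u x\<^sub>0 ** transpose (g x)"
proof -
  have uS: "u x \<in> unitary_sym" and u': "(u has_vector_derivative riccati_field (A x) (u x)) (at x)"
    if "x \<in> J" for x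
    using u that by (auto simp: riccati_flow_on_def)
  define X where "X x = riccati_xi (A x) (u x)" for x
  have dX: "dagger (X x) = - X x" if "x \<in> J" for x
    using riccati_xi_antihermitian[of "A x" "u x"] A uS that by (auto simp: X_def unitary_algebra_def)
  have "continuous_on J u"
    by (rule continuous_at_imp_continuous_on) (use u' has_vector_derivative_continuous in blast)
  then have X_cont: "continuous_on J X"
    unfolding X_def by (intro continuous_on_riccati_xi A_cont)
  define L :: "real \<Rightarrow> (complex ^ 'n ^ 'n) \<Rightarrow>\<^sub>L (complex ^ 'n ^ 'n)" where "L x = Blinfun ((**) (X x))" for x
  have L: "blinfun_apply (L x) = (**) (X x)" for x
    unfolding L_def by (rule bounded_linear_Blinfun_apply[OF matmul.bounded_linear_right])
  have "continuous_on J L"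
    by (rule continuous_on_blinfun_componentwise)
      (simp add: L matmul.continuous_on[OF X_cont continuous_on_const])
  from linear_ode_exists[OF J this] obtain g where g0: "g x\<^sub>0 = mat 1"
    and g': "\<And>x. x \<in> J \<Longrightarrow> (g has_vector_derivative X x ** g x) (at x)"
    unfolding L by blast
  have dg': "((\<lambda>x. dagger (g x)) has_vector_derivative - (dagger (g x) ** X x)) (at x)" if "x \<in> J" for x
    using bounded_linear.has_vector_derivative[OF bounded_linear_dagger g'[OF that]]
    by (simp add: dagger_mult dX[OF that] matmul.minus_right)
  have gU: "g x \<in> unitary_group" if "x \<in> J" for x
  proof -
    have "((\<lambda>x. dagger (g x) ** g x) has_vector_derivative 0) (at x)" if "x \<in> J" for x
      using matmul.has_vector_derivative[OF dg'[OF that] g'[OF that]]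
      by (simp add: matrix_mul_assoc matmul.minus_left)
    from constant_on_interval[OF J(2) this that J(3)] show ?thesis
      by (simp add: g0 unitary_group_iff)
  qed
  have u_eq: "u x = g x ** u x\<^sub>0 ** transpose (g x)" if x: "x \<in> J" for x
  proof -
    \<comment> \<open>This is u carried back by the group action: for unitary g, the inverses of g
      and g^T are g^dagger and conj(g).\<close>
    define w where "w x = dagger (g x) ** u x ** conj_mat (g x)" for x
    have "(w has_vector_derivative 0) (at x)" if "x \<in> J" for x
    proof -
      have "riccati_field (A x) (u x) = X x ** u x - u x ** conj_mat (X x)"
        unfolding X_def using A uS that by (intro riccati_field_xi) auto
      with u'[OF that] have u'': "(u has_vector_derivative X x ** u x - u x ** conj_mat (X x)) (at x)"
        by simp
      show ?thesis
        using matmul.has_vector_derivative[OF matmul.has_vector_derivative[OF dg'[OF that] u'']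
            bounded_linear.has_vector_derivative[OF bounded_linear_conj_mat g'[OF that]]]
        by (simp add: w_def[abs_def] conj_mat_mult matmul.diff_left matmul.diff_right matmul.add_left
            matmul.minus_left matrix_mul_assoc)
    qed
    from constant_on_interval[OF J(2) this x J(3)] have w: "w x = u x\<^sub>0"
      by (simp add: w_def g0)
    have "conj_mat (g x ** dagger (g x)) = conj_mat (g x) ** transpose (g x)"
      by (simp add: conj_mat_mult)
    then have "conj_mat (g x) ** transpose (g x) = mat 1"
      using unitary_groupD(2)[OF gU[OF x]] by simp
    moreover have "g x ** w x ** transpose (g x)
        = (g x ** dagger (g x)) ** u x ** (conj_mat (g x) ** transpose (g x))"
      by (simp add: w_def matrix_mul_assoc)
    ultimately show ?thesis
      using unitary_groupD(2)[OF gU[OF x]] by (simp add: w)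
  qed
  have "unitary_flow_on J A (u x\<^sub>0) g"
    unfolding unitary_flow_on_def using gU g' by (simp add: u_eq[symmetric] X_def)
  then show ?thesis using that g0 u_eq by blast
qed

text \<open>Since exp \<sigma> is invertible and its derivative is dexp(\<sigma>') exp \<sigma>,
  both flows amount to dexp(\<sigma>') = \<xi>. Differentiability of \<sigma> provides the \<sigma>'
  that the two equations share.\<close>

lemma lie_flow_on_iff_unitary_flow:
  assumes J: "open J" and A: "\<forall>x\<in>J. A x \<in> sp_algebra" and u\<^sub>0: "u\<^sub>0 \<in> unitary_sym"
    and \<sigma>_diff: "\<sigma> differentiable_on J"
    and \<sigma>: "\<And>x. x \<in> J \<Longrightarrow> \<sigma> x \<in> unitary_algebra" "\<And>x. x \<in> J \<Longrightarrow> dexp_invertible (\<sigma> x)"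
  shows "lie_flow_on J A u\<^sub>0 \<sigma> \<longleftrightarrow> unitary_flow_on J A u\<^sub>0 (\<lambda>x. mexp (\<sigma> x))"
proof -
  define X where "X x = riccati_xi (A x) (mexp (\<sigma> x) ** u\<^sub>0 ** transpose (mexp (\<sigma> x)))" for x
  have "(\<sigma> has_vector_derivative dexp_inv (\<sigma> x) (X x)) (at x) \<longleftrightarrow>
      ((\<lambda>x. mexp (\<sigma> x)) has_vector_derivative X x ** mexp (\<sigma> x)) (at x)" if x: "x \<in> J" for x
  proof -
    have E: "mexp (\<sigma> x) \<in> unitary_group" by (rule mexp_unitary[OF \<sigma>(1)[OF x]])
    have X: "X x \<in> unitary_algebra"
      unfolding X_def using A x E u\<^sub>0 by (intro riccati_xi_antihermitian unitary_sym_action) auto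
    have bij: "bij_betw (dexp (\<sigma> x)) unitary_algebra unitary_algebra"
      using \<sigma>(2)[OF x] by (simp add: dexp_invertible_def)
    obtain \<sigma>' where \<sigma>': "(\<sigma> has_vector_derivative \<sigma>') (at x)"
      using \<sigma>_diff x J vector_derivative_works unfolding differentiable_on_def
      by (metis at_within_open)
    \<comment> \<open>\<open>dexp_inv\<close> inverts \<open>dexp\<close> on the Lie algebra only,
      so \<sigma>' has to be placed there first.\<close>
    have "\<sigma>' \<in> unitary_algebra"
    proof -
      have "((\<lambda>x. dagger (\<sigma> x)) has_vector_derivative dagger \<sigma>') (at x)"
        by (rule bounded_linear.has_vector_derivative[OF bounded_linear_dagger \<sigma>'])
      then have "((\<lambda>x. - \<sigma> x) has_vector_derivative dagger \<sigma>') (at x)"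
        by (rule has_vector_derivative_transform_within_open[OF _ J x])
          (use \<sigma>(1) in \<open>simp add: unitary_algebra_def\<close>)
      then have "dagger \<sigma>' = - \<sigma>'"
        using has_vector_derivative_minus[OF \<sigma>'] vector_derivative_unique_at by blast
      then show ?thesis by (simp add: unitary_algebra_def)
    qed
    have "(\<sigma> has_vector_derivative dexp_inv (\<sigma> x) (X x)) (at x) \<longleftrightarrow> \<sigma>' = dexp_inv (\<sigma> x) (X x)"
      using \<sigma>' vector_derivative_unique_at by blast
    also have "\<dots> \<longleftrightarrow> dexp (\<sigma> x) \<sigma>' = X x"
      unfolding dexp_inv_def using bij \<open>\<sigma>' \<in> unitary_algebra\<close> X
      by (metis bij_betw_inv_into_left bij_betw_inv_into_right)
    also have "\<dots> \<longleftrightarrow> dexp (\<sigma> x) \<sigma>' ** mexp (\<sigma> x) = X x ** mexp (\<sigma> x)"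
      using unitary_groupD(2)[OF E] by (metis matrix_mul_assoc matrix_mul_rid)
    also have "\<dots> \<longleftrightarrow> ((\<lambda>x. mexp (\<sigma> x)) has_vector_derivative X x ** mexp (\<sigma> x)) (at x)"
      using has_vector_derivative_mexp[OF \<sigma>'] vector_derivative_unique_at by metis
    finally show ?thesis .
  qed
  then show ?thesis
    using \<sigma> mexp_unitary unfolding lie_flow_on_def unitary_flow_on_def X_def by blast
qed

section \<open>Local logarithm and local flow on the Lie algebra\<close>

lemma subspace_unitary_algebra: "subspace unitary_algebra"
  unfolding unitary_algebra_def
  by (rule subspaceI) (simp_all add: dagger_add linear_0[OF bounded_linear.linear[OF bounded_linear_dagger]]
      linear_cmul[OF bounded_linear.linear[OF bounded_linear_dagger]])

text \<open>Dimension count: an injective linear map of a finite-dimensional subspace into itself is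
  onto.\<close>

lemma dexp_invertible_if_inj:
  assumes "inj (dexp \<sigma>)" "\<sigma> \<in> unitary_algebra"
  shows "dexp_invertible \<sigma>"
proof -
  have "dexp \<sigma> ` unitary_algebra = unitary_algebra"
  proof (rule subspace_dim_equal)
    show "subspace (dexp \<sigma> ` unitary_algebra)"
      by (rule linear_subspace_image[OF linear_dexp subspace_unitary_algebra])
    show "dexp \<sigma> ` unitary_algebra \<subseteq> unitary_algebra"
      using assms(2) dexp_unitary_algebra by blast
    show "dim (unitary_algebra :: (complex ^ 'a ^ 'a) set) \<le> dim (dexp \<sigma> ` unitary_algebra)"
      by (subst dim_image_eq[OF linear_dexp]) (use assms(1) in \<open>auto intro: inj_on_subset\<close>)
  qed (rule subspace_unitary_algebra)
  then show ?thesis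
    unfolding dexp_invertible_def bij_betw_def using assms(1) inj_on_subset by blast
qed

lemma local_logarithm:
  obtains U V and l :: "complex ^ 'n ^ 'n \<Rightarrow> complex ^ 'n ^ 'n"
  where "open U" "0 \<in> U" "open V" "mat 1 \<in> V" "l (mat 1) = 0"
    "\<And>y. y \<in> V \<Longrightarrow> l y \<in> U" "\<And>y. y \<in> V \<Longrightarrow> mexp (l y) = y"
    "inj_on mexp U" "\<And>y. y \<in> V \<Longrightarrow> l differentiable (at y)"
    "\<And>y. y \<in> V \<Longrightarrow> inj (dexp (l y))"
proof -
  let ?f' = "\<lambda>\<sigma> h. dexp \<sigma> h ** mexp \<sigma> :: complex ^ 'n ^ 'n"
  define F :: "complex ^ 'n ^ 'n \<Rightarrow> (complex ^ 'n ^ 'n) \<Rightarrow>\<^sub>L (complex ^ 'n ^ 'n)"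
    where "F \<sigma> = Blinfun (?f' \<sigma>)" for \<sigma>
  have F: "blinfun_apply (F \<sigma>) = ?f' \<sigma>" for \<sigma>
    unfolding F_def
    by (rule bounded_linear_Blinfun_apply[OF has_derivative_bounded_linear[OF has_derivative_mexp]])
  have mexp_cont: "continuous_on UNIV (mexp :: complex ^ 'n ^ 'n \<Rightarrow> _)"
    by (rule continuous_at_imp_continuous_on) (use has_derivative_mexp has_derivative_continuous in blast)
  have F_cont: "continuous_on UNIV F"
    by (rule continuous_on_blinfun_componentwise)
      (simp add: F matmul.continuous_on[OF _ mexp_cont] continuous_at_imp_continuous_on isCont_dexp)
  have "dexp 0 h = h" for h :: "complex ^ 'n ^ 'n"
    by (rule dexp_commuting) (simp add: ad_def)
  \<comment> \<open>The derivative at 0 is the identity, so the identity is the inverse that the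
    inverse function theorem asks for.\<close>
  then have F0: "id_blinfun o\<^sub>L F 0 = id_blinfun"
    by (intro blinfun_eqI) (simp add: F mexp_0)
  have deriv: "(mexp has_derivative blinfun_apply (F \<sigma>)) (at \<sigma>)" for \<sigma>
    unfolding F by (rule has_derivative_mexp)
  obtain U V l l' where UV: "open U" "0 \<in> U" "open V" "mexp 0 \<in> V" "homeomorphism U V mexp l"
    and l': "\<And>y. y \<in> V \<Longrightarrow> (l has_derivative l' y) (at y)"
    and bij: "\<And>y. y \<in> V \<Longrightarrow> bij (blinfun_apply (F (l y)))"
    by (rule inverse_function_theorem[OF open_UNIV deriv F_cont UNIV_I F0]) (rule that; assumption)
  show thesis
  proof (rule that[of U V l])
    show "mat 1 \<in> V" "l (mat 1) = 0"
      using UV homeomorphism_apply1[OF UV(5,2)] by (simp_all add: mexp_0)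
    show "l y \<in> U" "mexp (l y) = y" if "y \<in> V" for y
      using UV(5) that by (auto simp: homeomorphism_def)
    show "inj_on mexp U"
      using homeomorphism_apply1[OF UV(5)] by (rule inj_on_inverseI)
    show "l differentiable (at y)" if "y \<in> V" for y
      using l'[OF that] by (auto simp: differentiable_def)
    \<comment> \<open>The bijective derivative is \<open>dexp (l y)\<close> followed by a right
      multiplication, so the inner map is injective.\<close>
    show "inj (dexp (l y))" if "y \<in> V" for y
      using bij_is_inj[OF bij[OF that]] unfolding F inj_def by metis
  qed (use UV in auto)
qed

lemma unitary_flow_local_lie_flow:
  fixes A :: "real \<Rightarrow> real ^ ('n::finite + 'n) ^ ('n + 'n)"
  assumes J: "open J" "x\<^sub>0 \<in> J" and A: "\<forall>x\<in>J. A x \<in> sp_algebra" and u\<^sub>0: "u\<^sub>0 \<in> unitary_sym"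
    and g: "unitary_flow_on J A u\<^sub>0 g" "g x\<^sub>0 = mat 1"
  obtains K \<sigma> where "open K" "is_interval K" "x\<^sub>0 \<in> K" "K \<subseteq> J"
    "lie_flow_on K A u\<^sub>0 \<sigma>" "\<sigma> x\<^sub>0 = 0" "\<And>x. x \<in> K \<Longrightarrow> g x = mexp (\<sigma> x)"
proof -
  obtain U V and l :: "complex ^ 'n ^ 'n \<Rightarrow> complex ^ 'n ^ 'n"
  where U: "open U" "0 \<in> U" and V: "open V" "mat 1 \<in> V" and l1: "l (mat 1) = 0"
    and lU: "\<And>y. y \<in> V \<Longrightarrow> l y \<in> U" and mexp_l: "\<And>y. y \<in> V \<Longrightarrow> mexp (l y) = y"
    and inj: "inj_on mexp U" and l': "\<And>y. y \<in> V \<Longrightarrow> l differentiable (at y)"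
    and inj': "\<And>y. y \<in> V \<Longrightarrow> inj (dexp (l y))"
    by (rule local_logarithm) blast
  define \<sigma> where "\<sigma> x = l (g x)" for x
  have g': "g differentiable (at x)" and gU: "g x \<in> unitary_group" if "x \<in> J" for x
    using g(1) that by (auto simp: unitary_flow_on_def intro: differentiableI_vector)
  have \<sigma>': "\<sigma> differentiable (at x)" if "x \<in> J" "g x \<in> V" for x
    unfolding \<sigma>_def[abs_def]
    using differentiable_chain_at[OF g'[OF that(1)] l'[OF that(2)]] by (simp add: o_def)
  have g_tendsto: "(g \<longlongrightarrow> mat 1) (nhds x\<^sub>0)" and \<sigma>_tendsto: "(\<sigma> \<longlongrightarrow> 0) (nhds x\<^sub>0)"
    using differentiable_imp_continuous_within[OF g'[OF J(2)]]
      differentiable_imp_continuous_within[OF \<sigma>'[OF J(2)]] g(2) V(2)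
    unfolding isCont_def tendsto_at_iff_tendsto_nhds by (simp_all add: \<sigma>_def l1)
  \<comment> \<open>The set U need not be stable under \<sigma> \<mapsto> -\<sigma>^dagger. Both
    curves vanish at the base point, so a smaller interval keeps this one in U as well.\<close>
  have "((\<lambda>x. - dagger (\<sigma> x)) \<longlongrightarrow> - dagger 0) (nhds x\<^sub>0)"
    by (intro tendsto_minus bounded_linear.tendsto[OF bounded_linear_dagger] \<sigma>_tendsto)
  moreover have "- dagger 0 = (0 :: complex ^ 'n ^ 'n)"
    by (simp add: linear_0[OF bounded_linear.linear[OF bounded_linear_dagger]])
  ultimately have "\<forall>\<^sub>F x in nhds x\<^sub>0. - dagger (\<sigma> x) \<in> U"
    using U by (auto intro: topological_tendstoD)
  moreover have "\<forall>\<^sub>F x in nhds x\<^sub>0. g x \<in> V"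
    using g_tendsto V by (rule topological_tendstoD)
  moreover have "\<forall>\<^sub>F x in nhds x\<^sub>0. x \<in> J" using J by (rule eventually_nhds_in_open)
  ultimately have "\<forall>\<^sub>F x in nhds x\<^sub>0. x \<in> J \<and> g x \<in> V \<and> - dagger (\<sigma> x) \<in> U"
    by eventually_elim simp
  then obtain e where "e > 0" and e: "\<And>x. x \<in> ball x\<^sub>0 e \<Longrightarrow> x \<in> J \<and> g x \<in> V \<and> - dagger (\<sigma> x) \<in> U"
    unfolding eventually_nhds_metric by (auto simp: dist_commute)
  define K where "K = ball x\<^sub>0 e"
  have K: "open K" "x\<^sub>0 \<in> K" "K \<subseteq> J" "is_interval K"
    using \<open>e > 0\<close> e by (auto simp: K_def is_interval_convex_1)
  have KV: "g x \<in> V" and KU: "- dagger (\<sigma> x) \<in> U" if "x \<in> K" for x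
    using e that by (auto simp: K_def)
  have mexp_\<sigma>: "mexp (\<sigma> x) = g x" if "x \<in> K" for x
    unfolding \<sigma>_def using mexp_l KV that by blast
  \<comment> \<open>both \<open>\<sigma>\<close> and \<open>- dagger \<sigma>\<close> are logarithms of \<open>g\<close> in \<open>U\<close>, since \<open>g\<close> is unitary\<close>
  have \<sigma>_anti: "\<sigma> x \<in> unitary_algebra" if x: "x \<in> K" for x
  proof -
    have gx: "g x \<in> unitary_group" using gU K x by blast
    have "mexp (- \<sigma> x) ** g x = mat 1" using mexp_minus_mult[of "\<sigma> x"] mexp_\<sigma>[OF x] by simp
    then have "mexp (- \<sigma> x) = dagger (g x)"
      using unitary_groupD[OF gx] by (metis matrix_mul_assoc matrix_mul_lid matrix_mul_rid)
    then have "mexp (- dagger (\<sigma> x)) = mexp (\<sigma> x)"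
      using dagger_mexp[of "- \<sigma> x"] by (simp add: dagger_minus mexp_\<sigma>[OF x])
    then have "- dagger (\<sigma> x) = \<sigma> x"
      using inj KU[OF x] lU[OF KV[OF x]] by (auto simp: \<sigma>_def inj_on_def)
    then show ?thesis unfolding unitary_algebra_def by (simp add: minus_equation_iff)
  qed
  have \<sigma>_diff: "\<sigma> differentiable_on K"
    using \<sigma>' K KV by (auto simp: differentiable_on_def intro: differentiable_at_withinI)
  have "unitary_flow_on K A u\<^sub>0 (\<lambda>x. mexp (\<sigma> x))"
    unfolding unitary_flow_on_def
  proof (intro ballI conjI)
    fix x assume x: "x \<in> K"
    then show "mexp (\<sigma> x) \<in> unitary_group" using gU K by (auto simp: mexp_\<sigma>)
    have "(g has_vector_derivative riccati_xi (A x) (g x ** u\<^sub>0 ** transpose (g x)) ** g x) (at x)"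
      using g(1) K(3) x by (auto simp: unitary_flow_on_def)
    then show "((\<lambda>x. mexp (\<sigma> x)) has_vector_derivative
        riccati_xi (A x) (mexp (\<sigma> x) ** u\<^sub>0 ** transpose (mexp (\<sigma> x))) ** mexp (\<sigma> x)) (at x)"
      unfolding mexp_\<sigma>[OF x]
      by (rule has_vector_derivative_transform_within_open[OF _ K(1) x]) (simp add: mexp_\<sigma>)
  qed
  moreover have "dexp_invertible (\<sigma> x)" if "x \<in> K" for x
    using dexp_invertible_if_inj inj' KV \<sigma>_anti that unfolding \<sigma>_def by blast
  ultimately have "lie_flow_on K A u\<^sub>0 \<sigma>"
    using lie_flow_on_iff_unitary_flow[OF K(1) _ u\<^sub>0 \<sigma>_diff \<sigma>_anti] A K(3) by blast
  then show ?thesis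
    using that K mexp_\<sigma> g(2) by (simp add: \<sigma>_def l1)
qed

theorem theorem5p2:
  fixes A :: "real \<Rightarrow> real ^ ('n::finite + 'n) ^ ('n + 'n)"
    and J :: "real set" and x\<^sub>0 :: real
  assumes "open J" and "is_interval J" and "x\<^sub>0 \<in> J"
    and "\<forall>x\<in>J. A x \<in> sp_algebra"
  shows
    \<comment> \<open>the flow of \<open>u\<close> is the Cayley image of the real Riccati flow\<close>
    "(\<forall>s. (\<forall>x\<in>J. transpose (s x) = s x) \<longrightarrow>
        (\<forall>x\<in>J. cayley (s x) \<in> unitary_sym) \<and>
        (real_riccati_flow_on J A s \<longleftrightarrow> riccati_flow_on J A (\<lambda>x. cayley (s x)))) \<and>
    \<comment> \<open>form of the vector field\<close>
     (\<forall>x\<in>J. \<forall>v\<in>unitary_sym.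
        riccati_xi (A x) v \<in> unitary_algebra \<and>
        riccati_field (A x) v = riccati_xi (A x) v ** v - v ** conj_mat (riccati_xi (A x) v)) \<and>
    \<comment> \<open>pullback to the unitary group\<close>
     (\<forall>u\<^sub>0\<in>unitary_sym. \<forall>g. unitary_flow_on J A u\<^sub>0 g \<and> g x\<^sub>0 = mat 1 \<longrightarrow>
        riccati_flow_on J A (\<lambda>x. g x ** u\<^sub>0 ** transpose (g x))) \<and>
     (continuous_on J A \<longrightarrow>
        (\<forall>u. riccati_flow_on J A u \<longrightarrow>
          (\<exists>g. unitary_flow_on J A (u x\<^sub>0) g \<and> g x\<^sub>0 = mat 1 \<and>
               (\<forall>x\<in>J. u x = g x ** u x\<^sub>0 ** transpose (g x))))) \<and>
    \<comment> \<open>pullback to the unitary Lie algebra\<close>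
     (\<forall>u\<^sub>0\<in>unitary_sym. \<forall>\<sigma>.
        \<sigma> x\<^sub>0 = 0 \<and> \<sigma> differentiable_on J \<and>
        (\<forall>x\<in>J. \<sigma> x \<in> unitary_algebra \<and> dexp_invertible (\<sigma> x)) \<longrightarrow>
          mexp (\<sigma> x\<^sub>0) = mat 1 \<and>
          (lie_flow_on J A u\<^sub>0 \<sigma> \<longleftrightarrow> unitary_flow_on J A u\<^sub>0 (\<lambda>x. mexp (\<sigma> x)))) \<and>
     (\<forall>u\<^sub>0\<in>unitary_sym. \<forall>g. unitary_flow_on J A u\<^sub>0 g \<and> g x\<^sub>0 = mat 1 \<longrightarrow>
        (\<exists>K \<sigma>. open K \<and> is_interval K \<and> x\<^sub>0 \<in> K \<and> K \<subseteq> J \<and>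
             lie_flow_on K A u\<^sub>0 \<sigma> \<and> \<sigma> x\<^sub>0 = 0 \<and> (\<forall>x\<in>K. g x = mexp (\<sigma> x))))"
proof (intro conjI allI impI ballI; (elim conjE)?)
  fix s :: "real \<Rightarrow> real ^ 'n ^ 'n" and x assume "\<forall>x\<in>J. transpose (s x) = s x" "x \<in> J"
  then show "cayley (s x) \<in> unitary_sym" by (simp add: cayley_unitary_sym)
next
  fix s :: "real \<Rightarrow> real ^ 'n ^ 'n" assume "\<forall>x\<in>J. transpose (s x) = s x"
  then show "real_riccati_flow_on J A s \<longleftrightarrow> riccati_flow_on J A (\<lambda>x. cayley (s x))"
    by (intro real_riccati_flow_on_iff_cayley assms) auto
next
  fix x and v :: "complex ^ 'n ^ 'n" assume "x \<in> J" "v \<in> unitary_sym"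
  then show "riccati_xi (A x) v \<in> unitary_algebra"
    "riccati_field (A x) v = riccati_xi (A x) v ** v - v ** conj_mat (riccati_xi (A x) v)"
    using assms(4) by (auto intro: riccati_xi_antihermitian riccati_field_xi)
next
  fix u\<^sub>0 :: "complex ^ 'n ^ 'n" and g assume "u\<^sub>0 \<in> unitary_sym" "unitary_flow_on J A u\<^sub>0 g"
  then show "riccati_flow_on J A (\<lambda>x. g x ** u\<^sub>0 ** transpose (g x))"
    using assms(4) by (intro unitary_flow_imp_riccati_flow)
next
  fix u assume "continuous_on J A" "riccati_flow_on J A u"
  then show "\<exists>g. unitary_flow_on J A (u x\<^sub>0) g \<and> g x\<^sub>0 = mat 1 \<and>
      (\<forall>x\<in>J. u x = g x ** u x\<^sub>0 ** transpose (g x))"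
    using riccati_flow_imp_unitary_flow[OF assms] by metis
next
  fix u\<^sub>0 :: "complex ^ 'n ^ 'n" and \<sigma> :: "real \<Rightarrow> complex ^ 'n ^ 'n" assume "\<sigma> x\<^sub>0 = 0"
  then show "mexp (\<sigma> x\<^sub>0) = mat 1" by (simp add: mexp_0)
next
  fix u\<^sub>0 :: "complex ^ 'n ^ 'n" and \<sigma> :: "real \<Rightarrow> complex ^ 'n ^ 'n"
  assume "u\<^sub>0 \<in> unitary_sym" "\<sigma> differentiable_on J"
    "\<forall>x\<in>J. \<sigma> x \<in> unitary_algebra \<and> dexp_invertible (\<sigma> x)"
  then show "lie_flow_on J A u\<^sub>0 \<sigma> \<longleftrightarrow> unitary_flow_on J A u\<^sub>0 (\<lambda>x. mexp (\<sigma> x))"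
    using assms(1,4) by (intro lie_flow_on_iff_unitary_flow) auto
next
  fix u\<^sub>0 :: "complex ^ 'n ^ 'n" and g
  assume "u\<^sub>0 \<in> unitary_sym" "unitary_flow_on J A u\<^sub>0 g" "g x\<^sub>0 = mat 1"
  from unitary_flow_local_lie_flow[OF assms(1,3,4) this]
  show "\<exists>K \<sigma>. open K \<and> is_interval K \<and> x\<^sub>0 \<in> K \<and> K \<subseteq> J \<and>
      lie_flow_on K A u\<^sub>0 \<sigma> \<and> \<sigma> x\<^sub>0 = 0 \<and> (\<forall>x\<in>K. g x = mexp (\<sigma> x))"
    by metis
qed

end
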